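(* Let $k\ge 2$ and let $G$ be a $k$-uniform hypergraph on $n$ vertices that satisfies the following conditions. (1) The vertex set is partitioned into three sets, $V(G)=C_1\cup C_2\cup D$, with $|C_1|=|C_2|=t$. (2) Every edge $e\in E(G)$ satisfies $|e\cap (C_1\cup C_2)|\le 1$. (3) For any $k-1$ distinct vertices $u_2,\dots,u_k\in D$, either $\Gamma(u_2,\dots,u_k)\cap (C_1\cup C_2)\in\{C_1,C_2\}$ or $|\Gamma(u_2,\dots,u_k)\cap C_1|=|\Gamma(u_2,\dots,u_k)\cap C_2|$. Let $H$ be the hypergraph on the vertex set $V(G)$ obtained from $G$ as follows: for every $(k-1)$-subset $\{u_2,\dots,u_k\}\subseteq D$ with $\Gamma(u_2,\dots,u_k)\cap(C_1\cup C_2)=C_1$ or $\Gamma(u_2,\dots,u_k)\cap(C_1\cup C_2)=C_2$, switch the adjacency of $\{u_1,u_2,\dots,u_k\}$ for all $u_1\in C_1\cup C_2$ (that is, $\{u_1,u_2,\dots,u_k\}$ is an edge of $H$ if and only if it is not an edge of $G$); all other $k$-subsets of $V(G)$ are edges of $H$ if and only if they are edges of $G$. Then $H$ is a $k$-uniform hypergraph that is $E$-cospectral with $G$.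
   Context: Hypergraphs are finite and simple. A hypergraph $G=(V(G),E(G))$ is $k$-uniform if each edge is a set of exactly $k$ distinct vertices. For distinct vertices $u_2,\dots,u_k$, the neighbourhood $\Gamma(u_2,\dots,u_k)$ is the set of vertices $u_1$ such that $\{u_1,u_2,\dots,u_k\}\in E(G)$. An order $k$ dimension $n$ tensor is an array $\mathcal{A}=(a_{i_1\cdots i_k})$ of complex numbers with $i_1,\dots,i_k\in[n]=\{1,\dots,n\}$. For $x=(x_1,\dots,x_n)^\top$, the vector $\mathcal{A}x$ has $i$-th component $(\mathcal{A}x)_i=\sum_{i_2,\dots,i_k\in[n]}a_{i\,i_2\cdots i_k}x_{i_2}\cdots x_{i_k}$. The $E$-characteristic polynomial of an order $k\ge 2$ dimension $n$ tensor $\mathcal{A}$ is the polynomial $\phi_{\mathcal{A}}(\lambda)$ defined as follows. If $k$ is even, $\phi_{\mathcal{A}}(\lambda)=\operatorname{Res}_x\big(\mathcal{A}x-\lambda(x^\top x)^{\frac{k-2}{2}}x\big)$, the resultant of the $n$ homogeneous polynomials in $x_1,\dots,x_n$ that are the components of this vector. If $k$ is odd, $\phi_{\mathcal{A}}(\lambda)=\operatorname{Res}_{x,\beta}\begin{pmatrix}\mathcal{A}x-\lambda\beta^{k-2}x\\ x^\top x-\beta^2\end{pmatrix}$, the resultant of the $n+1$ homogeneous polynomials in $x_1,\dots,x_n,\beta$ given by the components of $\mathcal{A}x-\lambda\beta^{k-2}x$ together with $x^\top x-\beta^2$. Here Res denotes the (multivariate) resultant of the system of polynomials. The adjacency tensor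 $\mathcal{A}_G$ of a $k$-uniform hypergraph $G$ is the tensor of order $k$ and dimension $|V(G)|$ with entries $a_{i_1\cdots i_k}=\frac{1}{(k-1)!}$ if $\{i_1,\dots,i_k\}\in E(G)$ and $a_{i_1\cdots i_k}=0$ otherwise. Two $k$-uniform hypergraphs are $E$-cospectral if their adjacency tensors have the same $E$-characteristic polynomial. *)

theory Defs
  imports Complex_Main "HOL-Library.Poly_Mapping" "HOL-Computational_Algebra.Polynomial"
begin

section \<open>Multivariate polynomials\<close>

text \<open>A monomial in variables of type \<open>'v\<close> is an exponent vector, and a polynomial is a finitely
  supported map from monomials to coefficients; \<open>Poly_Mapping\<close> supplies the ring structure.\<close>

type_synonym 'v monomial = "'v \<Rightarrow>\<^sub>0 nat"
type_synonym ('v, 'r) mpol = "'v monomial \<Rightarrow>\<^sub>0 'r"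

definition mvar :: "'v \<Rightarrow> ('v, 'r::comm_ring_1) mpol" where
  "mvar v = Poly_Mapping.single (Poly_Mapping.single v 1) 1"

definition mconst :: "'r::comm_ring_1 \<Rightarrow> ('v, 'r) mpol" where
  "mconst c = Poly_Mapping.single 0 c"

definition eval_int_mpol :: "('v, int) mpol \<Rightarrow> ('v \<Rightarrow> 'r::comm_ring_1) \<Rightarrow> 'r" where
  "eval_int_mpol p c = (\<Sum>m\<in>Poly_Mapping.keys p.
     of_int (Poly_Mapping.lookup p m) *
       (\<Prod>v\<in>Poly_Mapping.keys m. c v ^ Poly_Mapping.lookup m v))"


section \<open>The multivariate resultant\<close>

text \<open>Variables and equations are indexed by the same finite set \<open>I\<close>; the \<open>i\<close>-th equation is a
  form of degree \<open>d i\<close>. The coefficient of \<open>x\<^sup>\<alpha>\<close> in the \<open>i\<close>-th form is the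
  indeterminate \<open>(i, \<alpha>)\<close>.\<close>

definition monomials_of_degree :: "'v set \<Rightarrow> nat \<Rightarrow> 'v monomial set" where
  "monomials_of_degree I m =
     {\<alpha>. Poly_Mapping.keys \<alpha> \<subseteq> I \<and> (\<Sum>v\<in>I. Poly_Mapping.lookup \<alpha> v) = m}"

definition form_value ::
  "'v set \<Rightarrow> nat \<Rightarrow> ('v monomial \<Rightarrow> complex) \<Rightarrow> ('v \<Rightarrow> complex) \<Rightarrow> complex" where
  "form_value I m c x =
     (\<Sum>\<alpha>\<in>monomials_of_degree I m. c \<alpha> * (\<Prod>v\<in>I. x v ^ Poly_Mapping.lookup \<alpha> v))"

definition has_nontrivial_zero ::
  "'v set \<Rightarrow> ('v \<Rightarrow> nat) \<Rightarrow> ('v \<times> 'v monomial \<Rightarrow> complex) \<Rightarrow> bool" where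
  "has_nontrivial_zero I d c \<longleftrightarrow>
     (\<exists>x. (\<exists>v\<in>I. x v \<noteq> 0) \<and> (\<forall>i\<in>I. form_value I (d i) (\<lambda>\<alpha>. c (i, \<alpha>)) x = 0))"

text \<open>The standard definition of the (generic) resultant: the unique integer polynomial in the
  coefficients of the forms that is irreducible over the complex numbers, vanishes exactly at the
  systems with a nontrivial common zero, and takes the value \<open>1\<close> at the system of the forms
  \<open>x\<^sub>i ^ d i\<close>.\<close>

definition is_generic_resultant ::
  "'v set \<Rightarrow> ('v \<Rightarrow> nat) \<Rightarrow> ('v \<times> 'v monomial, int) mpol \<Rightarrow> bool" where
  "is_generic_resultant I d R \<longleftrightarrow>
     (\<forall>m\<in>Poly_Mapping.keys R. Poly_Mapping.keys m \<subseteq> (SIGMA i:I. monomials_of_degree I (d i))) \<and>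
     irreducible (Poly_Mapping.map of_int R :: ('v \<times> 'v monomial, complex) mpol) \<and>
     (\<forall>c :: 'v \<times> 'v monomial \<Rightarrow> complex.
        eval_int_mpol R c = 0 \<longleftrightarrow> has_nontrivial_zero I d c) \<and>
     eval_int_mpol R
       (\<lambda>(i, \<alpha>). if \<alpha> = Poly_Mapping.single i (d i) then 1 else (0::int)) = 1"

text \<open>The resultant of forms \<open>F i\<close> over an arbitrary commutative ring, of prescribed degrees
  \<open>d i\<close>, is obtained by substituting their coefficients into the generic resultant. By
  elimination theory the generic resultant exists uniquely whenever \<open>I\<close> is finite and nonempty and
  all degrees are positive, so the \<open>else\<close> branch matters only outside this range; the resultant
  of the empty system is \<open>1\<close>.\<close>

definition resultant ::
  "'v set \<Rightarrow> ('v \<Rightarrow> nat) \<Rightarrow> ('v \<Rightarrow> ('v, 'r::comm_ring_1) mpol) \<Rightarrow> 'r" where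
  "resultant I d F =
     (if \<exists>R. is_generic_resultant I d R
      then eval_int_mpol (SOME R. is_generic_resultant I d R)
             (\<lambda>(i, \<alpha>). Poly_Mapping.lookup (F i) \<alpha>)
      else 1)"


section \<open>Tensors and the E-characteristic polynomial\<close>

text \<open>An order \<open>k\<close> tensor with index set \<open>I\<close> is a function on the lists of length \<open>k\<close> over \<open>I\<close>;
  its values on other lists are irrelevant. Tensors of a hypergraph are indexed by the vertices
  themselves, which avoids choosing a numbering.\<close>

definition tensor_apply ::
  "'i set \<Rightarrow> nat \<Rightarrow> ('i list \<Rightarrow> 'r::comm_ring_1) \<Rightarrow> ('i \<Rightarrow> 'r) \<Rightarrow> 'i \<Rightarrow> 'r" where
  "tensor_apply I k A x i =
     (\<Sum>js\<in>{js. set js \<subseteq> I \<and> length js = k - 1}. A (i # js) * (\<Prod>j\<leftarrow>js. x j))"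

text \<open>Polynomials in \<open>x\<close> have coefficients in the ring \<open>complex poly\<close> of polynomials in \<open>\<lambda>\<close>, where
  \<open>\<lambda>\<close> is \<open>[:0, 1:]\<close>. For odd \<open>k\<close> the variable \<open>x\<^sub>i\<close> is indexed by \<open>Some i\<close>, and both
  \<open>\<beta>\<close> and the additional equation are indexed by \<open>None\<close>.\<close>

definition E_system_even ::
  "'i set \<Rightarrow> nat \<Rightarrow> ('i list \<Rightarrow> complex) \<Rightarrow> 'i \<Rightarrow> ('i, complex poly) mpol" where
  "E_system_even I k A i =
     tensor_apply I k (\<lambda>is. mconst [:A is:]) mvar i
     - mconst [:0, 1:] * (\<Sum>j\<in>I. mvar j ^ 2) ^ ((k - 2) div 2) * mvar i"

fun E_system_odd ::
  "'i set \<Rightarrow> nat \<Rightarrow> ('i list \<Rightarrow> complex) \<Rightarrow> 'i option \<Rightarrow> ('i option, complex poly) mpol" where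
  "E_system_odd I k A (Some i) =
     tensor_apply I k (\<lambda>is. mconst [:A is:]) (\<lambda>j. mvar (Some j)) i
     - mconst [:0, 1:] * mvar None ^ (k - 2) * mvar (Some i)"
| "E_system_odd I k A None = (\<Sum>j\<in>I. mvar (Some j) ^ 2) - mvar None ^ 2"

definition E_charpoly :: "'i set \<Rightarrow> nat \<Rightarrow> ('i list \<Rightarrow> complex) \<Rightarrow> complex poly" where
  "E_charpoly I k A =
     (if even k then resultant I (\<lambda>_. k - 1) (E_system_even I k A)
      else resultant (insert None (Some ` I)) (case_option 2 (\<lambda>_. k - 1)) (E_system_odd I k A))"


section \<open>Hypergraphs\<close>

definition uniform_hypergraph :: "nat \<Rightarrow> 'a set \<Rightarrow> 'a set set \<Rightarrow> bool" where
  "uniform_hypergraph k V E \<longleftrightarrow> finite V \<and> (\<forall>e\<in>E. e \<subseteq> V \<and> card e = k)"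

text \<open>The neighbourhood of distinct vertices \<open>u\<^sub>2, \<dots>, u\<^sub>k\<close> depends only on the set
  \<open>S\<close> of these vertices. If \<open>card S = k - 1\<close>, then \<open>insert u S\<close> can only be an edge for
  \<open>u \<notin> S\<close>.\<close>

definition nbhd :: "'a set set \<Rightarrow> 'a set \<Rightarrow> 'a set" where
  "nbhd E S = {u. insert u S \<in> E}"

definition adjacency_tensor :: "nat \<Rightarrow> 'a set set \<Rightarrow> 'a list \<Rightarrow> complex" where
  "adjacency_tensor k E is = (if set is \<in> E then 1 / fact (k - 1) else 0)"

definition E_cospectral :: "nat \<Rightarrow> 'a set \<Rightarrow> 'a set set \<Rightarrow> 'b set \<Rightarrow> 'b set set \<Rightarrow> bool" where
  "E_cospectral k V E W F \<longleftrightarrow>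
     E_charpoly V k (adjacency_tensor k E) = E_charpoly W k (adjacency_tensor k F)"

definition is_switched ::
  "nat \<Rightarrow> 'a set set \<Rightarrow> 'a set \<Rightarrow> 'a set \<Rightarrow> 'a set \<Rightarrow> 'a set \<Rightarrow> bool" where
  "is_switched k E C1 C2 D e \<longleftrightarrow>
     (\<exists>S u. S \<subseteq> D \<and> card S = k - 1 \<and> nbhd E S \<inter> (C1 \<union> C2) \<in> {C1, C2} \<and>
            u \<in> C1 \<union> C2 \<and> e = insert u S)"

definition switched_edges ::
  "nat \<Rightarrow> 'a set \<Rightarrow> 'a set set \<Rightarrow> 'a set \<Rightarrow> 'a set \<Rightarrow> 'a set \<Rightarrow> 'a set set" where
  "switched_edges k V E C1 C2 D =
     {e. e \<subseteq> V \<and> card e = k \<and> (if is_switched k E C1 C2 D e then e \<notin> E else e \<in> E)}"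

end

theory Submission
  imports
    Defs
    "HOL-Computational_Algebra.Fundamental_Theorem_Algebra"
    "HOL-Combinatorics.Multiset_Permutations"
begin

text \<open>Let \<open>w\<close> be the vector that is \<open>1\<close> on \<open>C1\<close>, \<open>- 1\<close> on \<open>C2\<close> and \<open>0\<close> on \<open>D\<close>, and let
  \<open>Q = 1 - (1 / t) w w\<^sup>T\<close> be the reflection that negates \<open>w\<close>. It is the analogue of the
  Godsil--McKay matrix: it exchanges the indicator vectors of \<open>C1\<close> and \<open>C2\<close> and fixes those of
  subsets that meet \<open>C1\<close> and \<open>C2\<close> equally. Hence it maps the neighbourhood, within \<open>C1 \<union> C2\<close>, of
  each \<open>(k - 1)\<close>-subset of \<open>D\<close> to its neighbourhood in the switched hypergraph (\<open>adj_switched\<close>).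
  Since an edge has at most one vertex in \<open>C1 \<union> C2\<close>, this suffices for the adjacency tensors to
  satisfy \<open>A\<^sub>H x = Q (A\<^sub>G (Q x))\<close> (\<open>tensor_apply_reflected\<close>), and since \<open>Q\<close> is orthogonal, the same
  relation holds between the systems of forms whose resultants are the E-characteristic polynomials.

  It remains to see that the resultant of a system \<open>F\<close> equals that of \<open>Q (F (Q x))\<close>. The argument
  rests on two properties of the generic resultant: it is a polynomial in the coefficients of the
  forms, and its zeros are the systems with a nontrivial zero. If \<open>F\<close> has a nontrivial zero, so has
  \<open>Q (F (Q x))\<close>, and both resultants vanish. Otherwise join the identity to \<open>Q\<close> by the path
  \<open>M\<^sub>s = 1 - s w w\<^sup>T\<close>, which is singular for a single \<open>s\<close> half way. The resultant of
  \<open>M\<^sub>s (F (M\<^sub>s x))\<close> is a polynomial in \<open>s\<close> with no other root, that is, a power \<open>b (s - s\<^sub>0)\<^sup>n\<close>, and so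
  its values at the ends of the path agree up to sign
  (\<open>generic_resultant_reflected_up_to_sign\<close>). The sign cannot depend on \<open>F\<close>: two polynomials with
  equal squares on a line in the space of systems are equal or opposite on the whole line. So it is
  \<open>1\<close> as soon as some system is fixed by the reflection and has no nontrivial zero
  (\<open>generic_resultant_reflected\<close>). Such systems are written down in \<open>fixed_system_odd_degree\<close>, for
  even \<open>k\<close>, and in \<open>fixed_system_even_degree\<close>, for odd \<open>k\<close>, where the additional variable \<open>\<beta>\<close>
  takes part.\<close>

section \<open>Evaluation and homogeneity of polynomials\<close>

text \<open>One evaluation serves two purposes: the parameter \<open>s\<close> stands for the spectral variable
  \<open>\<lambda>\<close> when the E-system of a tensor is evaluated, and for the parameter of a path of linear maps
  when a system of forms is deformed.\<close>
definition mpol_value ::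
  "'v set \<Rightarrow> complex \<Rightarrow> ('v \<Rightarrow> complex) \<Rightarrow> ('v, complex poly) mpol \<Rightarrow> complex" where
  "mpol_value I s x p = (\<Sum>\<alpha>\<in>Poly_Mapping.keys p.
     poly (Poly_Mapping.lookup p \<alpha>) s * (\<Prod>v\<in>I. x v ^ Poly_Mapping.lookup \<alpha> v))"

definition is_form :: "'v set \<Rightarrow> nat \<Rightarrow> ('v, 'r::comm_ring_1) mpol \<Rightarrow> bool" where
  "is_form I m p \<longleftrightarrow> Poly_Mapping.keys p \<subseteq> monomials_of_degree I m"

lemma mpol_value_superset:
  assumes "finite A" "Poly_Mapping.keys p \<subseteq> A"
  shows "mpol_value I s x p =
    (\<Sum>\<alpha>\<in>A. poly (Poly_Mapping.lookup p \<alpha>) s * (\<Prod>v\<in>I. x v ^ Poly_Mapping.lookup \<alpha> v))"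
  unfolding mpol_value_def using assms
  by (intro sum.mono_neutral_left) (auto simp: in_keys_iff)

lemma mpol_value_zero [simp]: "mpol_value I s x 0 = 0"
  by (simp add: mpol_value_def)

lemma mpol_value_add [simp]:
  "mpol_value I s x (p + q) = mpol_value I s x p + mpol_value I s x q"
proof -
  let ?A = "Poly_Mapping.keys p \<union> Poly_Mapping.keys q"
  have A: "finite ?A" "Poly_Mapping.keys (p + q) \<subseteq> ?A" by (auto simp: keys_add)
  show ?thesis
    by (simp add: mpol_value_superset[OF A] mpol_value_superset[OF A(1), of p]
        mpol_value_superset[OF A(1), of q] lookup_add distrib_right sum.distrib)
qed

lemma mpol_value_uminus [simp]: "mpol_value I s x (- p) = - mpol_value I s x p"
  by (simp add: mpol_value_def sum_negf)

lemma mpol_value_diff [simp]: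
  "mpol_value I s x (p - q) = mpol_value I s x p - mpol_value I s x q"
  using mpol_value_add[of I s x p "- q"] by simp

lemma mpol_value_sum [simp]:
  "mpol_value I s x (\<Sum>a\<in>A. f a) = (\<Sum>a\<in>A. mpol_value I s x (f a))"
  by (induction A rule: infinite_finite_induct) auto

lemma mpol_value_single:
  "mpol_value I s x (Poly_Mapping.single \<alpha> c) =
     poly c s * (\<Prod>v\<in>I. x v ^ Poly_Mapping.lookup \<alpha> v)"
  by (cases "c = 0") (auto simp: mpol_value_def)

lemma mpol_as_sum_of_terms:
  "p = (\<Sum>\<alpha>\<in>Poly_Mapping.keys p. Poly_Mapping.single \<alpha> (Poly_Mapping.lookup p \<alpha>))"
  by (rule poly_mapping_eqI)
     (auto simp: lookup_sum lookup_single when_def sum.delta' in_keys_iff)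

lemma mpol_value_mult [simp]:
  "mpol_value I s x (p * q) = mpol_value I s x p * mpol_value I s x q"
proof -
  have single: "mpol_value I s x (Poly_Mapping.single \<alpha> a * Poly_Mapping.single \<beta> b) =
      mpol_value I s x (Poly_Mapping.single \<alpha> a) * mpol_value I s x (Poly_Mapping.single \<beta> b)"
    for \<alpha> \<beta> a b
    by (simp add: mult_single mpol_value_single lookup_add power_add prod.distrib)
  have "mpol_value I s x
      ((\<Sum>\<alpha>\<in>Poly_Mapping.keys p. Poly_Mapping.single \<alpha> (Poly_Mapping.lookup p \<alpha>)) *
       (\<Sum>\<beta>\<in>Poly_Mapping.keys q. Poly_Mapping.single \<beta> (Poly_Mapping.lookup q \<beta>))) =
    mpol_value I s x (\<Sum>\<alpha>\<in>Poly_Mapping.keys p. Poly_Mapping.single \<alpha> (Poly_Mapping.lookup p \<alpha>)) *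
    mpol_value I s x (\<Sum>\<beta>\<in>Poly_Mapping.keys q. Poly_Mapping.single \<beta> (Poly_Mapping.lookup q \<beta>))"
    by (simp add: sum_product single)
  then show ?thesis by (simp only: mpol_as_sum_of_terms[symmetric])
qed

lemma mpol_value_mconst [simp]: "mpol_value I s x (mconst c) = poly c s"
  by (simp add: mconst_def mpol_value_single)

lemma mpol_value_mvar [simp]:
  assumes "finite I" "v \<in> I"
  shows "mpol_value I s x (mvar v) = x v"
proof -
  have "(\<Prod>u\<in>I. x u ^ Poly_Mapping.lookup (Poly_Mapping.single v (1::nat)) u) =
        (\<Prod>u\<in>I. if u = v then x u else 1)"
    by (intro prod.cong) (auto simp: lookup_single when_def)
  then show ?thesis using assms by (simp add: mvar_def mpol_value_single prod.delta)
qed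

lemma mpol_value_one [simp]: "mpol_value I s x 1 = 1"
  using mpol_value_mconst[of I s x 1] by (simp add: mconst_def single_one del: mpol_value_mconst)

lemma mpol_value_power [simp]: "mpol_value I s x (p ^ n) = mpol_value I s x p ^ n"
  by (induction n) auto

lemma mpol_value_prod [simp]:
  "mpol_value I s x (\<Prod>a\<in>A. f a) = (\<Prod>a\<in>A. mpol_value I s x (f a))"
  by (induction A rule: infinite_finite_induct) auto

lemma mpol_value_prod_list [simp]:
  "mpol_value I s x (prod_list ps) = prod_list (map (mpol_value I s x) ps)"
  by (induction ps) auto

lemma is_form_add: "is_form I m p \<Longrightarrow> is_form I m q \<Longrightarrow> is_form I m (p + q)"
  using keys_add[of p q] by (auto simp: is_form_def)

lemma is_form_diff: "is_form I m p \<Longrightarrow> is_form I m q \<Longrightarrow> is_form I m (p - q)"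
  using keys_diff[of p q] by (auto simp: is_form_def)

lemma is_form_sum: "(\<And>a. a \<in> A \<Longrightarrow> is_form I m (f a)) \<Longrightarrow> is_form I m (\<Sum>a\<in>A. f a)"
  using keys_sum[of f A] unfolding is_form_def by fast

lemma is_form_mult:
  assumes "is_form I m p" "is_form I m' q" "n = m + m'"
  shows "is_form I n (p * q)"
proof -
  have "\<alpha> + \<beta> \<in> monomials_of_degree I n"
    if "\<alpha> \<in> monomials_of_degree I m" "\<beta> \<in> monomials_of_degree I m'" for \<alpha> \<beta>
    using that keys_add[of \<alpha> \<beta>] assms(3)
    by (auto simp: monomials_of_degree_def lookup_add sum.distrib)
  then show ?thesis
    using assms(1,2) keys_mult[of p q] unfolding is_form_def by fast
qed

lemma is_form_mconst: "is_form I 0 (mconst c)"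
  by (auto simp: is_form_def mconst_def monomials_of_degree_def)

lemma is_form_mconst_mult: "is_form I m p \<Longrightarrow> is_form I m (mconst c * p)"
  by (rule is_form_mult[OF is_form_mconst]) auto

lemma is_form_one: "is_form I 0 1"
  using is_form_mconst[of I 1] by (simp add: mconst_def single_one)

lemma is_form_mvar:
  assumes "finite I" "v \<in> I"
  shows "is_form I 1 (mvar v)"
proof -
  have "(\<Sum>u\<in>I. Poly_Mapping.lookup (Poly_Mapping.single v (1::nat)) u) = 1"
    using assms by (simp add: lookup_single when_def)
  then show ?thesis using assms by (auto simp: is_form_def mvar_def monomials_of_degree_def)
qed

lemma is_form_power:
  assumes "is_form I m p" "d = n * m"
  shows "is_form I d (p ^ n)"
  unfolding assms(2)
  by (induction n) (auto intro: is_form_one is_form_mult[OF assms(1)])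

lemma is_form_prod:
  assumes "finite A" "\<And>a. a \<in> A \<Longrightarrow> is_form I (m a) (f a)"
  shows "is_form I (\<Sum>a\<in>A. m a) (\<Prod>a\<in>A. f a)"
  using assms
  by (induction A) (auto intro: is_form_one is_form_mult)

lemma is_form_prod_list:
  assumes "\<And>p. p \<in> set ps \<Longrightarrow> is_form I 1 p"
  shows "is_form I (length ps) (prod_list ps)"
  using assms
  by (induction ps) (auto intro: is_form_one is_form_mult[where m = 1])

section \<open>Forms are determined by their values\<close>

text \<open>Monomials are compared by their exponents inside \<open>I\<close>. This form of distinctness, unlike
  plain distinctness, makes sense for an arbitrary set of monomials and a shrinking set of variables,
  as the induction in \<open>vanishing_sum_of_monomials\<close> requires.\<close>
lemma inj_on_restrict_monomials:
  "inj_on (\<lambda>\<alpha>. restrict (Poly_Mapping.lookup \<alpha>) I) (monomials_of_degree I m)"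
proof (rule inj_onI, rule poly_mapping_eqI)
  fix \<alpha> \<beta> v
  assume *: "\<alpha> \<in> monomials_of_degree I m" "\<beta> \<in> monomials_of_degree I m"
    "restrict (Poly_Mapping.lookup \<alpha>) I = restrict (Poly_Mapping.lookup \<beta>) I"
  show "Poly_Mapping.lookup \<alpha> v = Poly_Mapping.lookup \<beta> v"
  proof (cases "v \<in> I")
    case True
    then show ?thesis using fun_cong[OF *(3), of v] by simp
  next
    case False
    then have "v \<notin> Poly_Mapping.keys \<alpha>" "v \<notin> Poly_Mapping.keys \<beta>"
      using *(1,2) by (auto simp: monomials_of_degree_def)
    then show ?thesis by (simp add: in_keys_iff)
  qed
qed

lemma finite_monomials_of_degree:
  assumes "finite I"
  shows "finite (monomials_of_degree I m)"
proof (rule inj_on_finite)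
  show "inj_on (\<lambda>\<alpha>. restrict (Poly_Mapping.lookup \<alpha>) I) (monomials_of_degree I m)"
    by (rule inj_on_restrict_monomials)
  show "(\<lambda>\<alpha>. restrict (Poly_Mapping.lookup \<alpha>) I) ` monomials_of_degree I m \<subseteq> I \<rightarrow>\<^sub>E {..m}"
    using assms by (auto simp: monomials_of_degree_def intro: member_le_sum)
  show "finite (I \<rightarrow>\<^sub>E {..m})" using assms by (intro finite_PiE) auto
qed

lemma form_value_is_form:
  assumes "finite I" "is_form I m p"
  shows "form_value I m (\<lambda>\<alpha>. poly (Poly_Mapping.lookup p \<alpha>) s) x = mpol_value I s x p"
  unfolding form_value_def
  using mpol_value_superset[OF finite_monomials_of_degree[OF assms(1)]] assms(2)
  by (simp add: is_form_def)

text \<open>The identity principle over the complex numbers, by induction on the variables: for fixed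
  values of the other variables the sum is a univariate polynomial in \<open>x\<^sub>w\<close> that vanishes
  everywhere, so for each exponent of \<open>x\<^sub>w\<close> the terms with that exponent already sum to zero.\<close>
lemma vanishing_sum_of_monomials:
  fixes c :: "'v monomial \<Rightarrow> complex"
  assumes "finite I" "finite S" "inj_on (\<lambda>\<alpha>. restrict (Poly_Mapping.lookup \<alpha>) I) S"
    and "\<And>x. (\<Sum>\<alpha>\<in>S. c \<alpha> * (\<Prod>v\<in>I. x v ^ Poly_Mapping.lookup \<alpha> v)) = 0"
    and "\<alpha> \<in> S"
  shows "c \<alpha> = 0"
  using assms
proof (induction I arbitrary: S \<alpha> rule: finite_induct)
  case empty
  then have "S = {\<alpha>}" by (auto simp: inj_on_def restrict_def)
  then show ?case using empty.prems(3)[of "\<lambda>_. 0"] by simp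
next
  case (insert w I)
  define j where "j = Poly_Mapping.lookup \<alpha> w"
  define T where "T i = {\<beta>\<in>S. Poly_Mapping.lookup \<beta> w = i}" for i
  define q where "q x \<beta> = c \<beta> * (\<Prod>v\<in>I. x v ^ Poly_Mapping.lookup \<beta> v)" for x :: "'v \<Rightarrow> complex" and \<beta>
  have "(\<Sum>\<beta>\<in>T j. q x \<beta>) = 0" for x
  proof -
    define p where "p = (\<Sum>\<beta>\<in>S. monom (q x \<beta>) (Poly_Mapping.lookup \<beta> w))"
    have "poly p z = 0" for z
    proof -
      have "(\<Prod>v\<in>I. (x(w := z)) v ^ Poly_Mapping.lookup \<beta> v) =
          (\<Prod>v\<in>I. x v ^ Poly_Mapping.lookup \<beta> v)" for \<beta>
        using insert.hyps by (intro prod.cong) auto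
      then show ?thesis
        using insert.prems(3)[of "x(w := z)"] insert.hyps
        by (simp add: p_def q_def poly_sum poly_monom mult_ac)
    qed
    then have "p = 0" using poly_all_0_iff_0 by blast
    then have "coeff p j = 0" by simp
    then show ?thesis
      using insert.prems(1) by (simp add: p_def coeff_sum T_def sum.inter_filter)
  qed
  moreover have "inj_on (\<lambda>\<beta>. restrict (Poly_Mapping.lookup \<beta>) I) (T j)"
  proof (rule inj_onI)
    fix \<beta> \<gamma>
    assume *: "\<beta> \<in> T j" "\<gamma> \<in> T j"
      "restrict (Poly_Mapping.lookup \<beta>) I = restrict (Poly_Mapping.lookup \<gamma>) I"
    have "Poly_Mapping.lookup \<beta> v = Poly_Mapping.lookup \<gamma> v" if "v \<in> I" for v
      using fun_cong[OF *(3), of v] that by simp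
    then have "restrict (Poly_Mapping.lookup \<beta>) (insert w I) =
        restrict (Poly_Mapping.lookup \<gamma>) (insert w I)"
      using *(1,2) by (auto simp: T_def restrict_def)
    then show "\<beta> = \<gamma>" by (rule inj_onD[OF insert.prems(2)]) (use *(1,2) in \<open>auto simp: T_def\<close>)
  qed
  moreover have "finite (T j)" "\<alpha> \<in> T j" using insert.prems by (auto simp: T_def j_def)
  ultimately show ?case unfolding q_def by (intro insert.IH[of "T j"])
qed

text \<open>This allows every identity between systems of forms to be checked on values, although the
  resultant is a function of the coefficients.\<close>
lemma form_value_determines_coefficients:
  assumes "finite I" "\<And>x. form_value I m c x = form_value I m c' x"
    and "\<alpha> \<in> monomials_of_degree I m"
  shows "c \<alpha> = c' \<alpha>"
proof -
  have "c \<alpha> - c' \<alpha> = 0"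
    by (rule vanishing_sum_of_monomials[OF assms(1) finite_monomials_of_degree[OF assms(1)]
          inj_on_restrict_monomials _ assms(3)])
       (use assms(2) in \<open>simp add: form_value_def left_diff_distrib sum_subtractf\<close>)
  then show ?thesis by simp
qed

section \<open>Reflections\<close>

text \<open>The matrix \<open>M\<^sub>s = 1 - s w w\<^sup>T\<close>. For \<open>s = 2 / (w \<bullet> w)\<close> it is the reflection that
  negates \<open>w\<close>, provided that \<open>w \<bullet> w \<noteq> 0\<close>; then \<open>M\<^sub>s\<close> is singular exactly for
  \<open>s = 1 / (w \<bullet> w)\<close>, half way between the identity at \<open>s = 0\<close> and the reflection.\<close>
definition reflect :: "'v set \<Rightarrow> ('v \<Rightarrow> complex) \<Rightarrow> complex \<Rightarrow> ('v \<Rightarrow> complex) \<Rightarrow> 'v \<Rightarrow> complex" where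
  "reflect I w s x = (\<lambda>v. x v - s * w v * (\<Sum>l\<in>I. w l * x l))"

lemma dot_reflect:
  "(\<Sum>l\<in>I. w l * reflect I w s x l) = (1 - s * (\<Sum>l\<in>I. w l ^ 2)) * (\<Sum>l\<in>I. w l * x l)"
proof -
  have "(\<Sum>l\<in>I. w l * reflect I w s x l) =
      (\<Sum>l\<in>I. w l * x l) - (\<Sum>l\<in>I. s * (\<Sum>l\<in>I. w l * x l) * w l ^ 2)"
    by (simp add: reflect_def right_diff_distrib sum_subtractf power2_eq_square mult_ac)
  also have "\<dots> = (\<Sum>l\<in>I. w l * x l) - s * (\<Sum>l\<in>I. w l * x l) * (\<Sum>l\<in>I. w l ^ 2)"
    by (simp only: sum_distrib_left)
  finally show ?thesis by (simp add: algebra_simps)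
qed

lemma reflect_eq_zeroD:
  assumes "s * (\<Sum>l\<in>I. w l ^ 2) \<noteq> 1" "\<And>i. i \<in> I \<Longrightarrow> reflect I w s x i = 0" "i \<in> I"
  shows "x i = 0"
proof -
  have "(1 - s * (\<Sum>l\<in>I. w l ^ 2)) * (\<Sum>l\<in>I. w l * x l) = 0"
    using assms(2) by (simp flip: dot_reflect)
  then have "(\<Sum>l\<in>I. w l * x l) = 0" using assms(1) by simp
  then show ?thesis using assms(2)[OF assms(3)] by (simp add: reflect_def)
qed

lemma reflect_cong: "(\<And>i. i \<in> I \<Longrightarrow> x i = y i) \<Longrightarrow> i \<in> I \<Longrightarrow> reflect I w s x i = reflect I w s y i"
  by (simp add: reflect_def)

lemma reflect_reflect:
  assumes "(\<Sum>l\<in>I. w l ^ 2) \<noteq> 0"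
  shows "reflect I w (2 / (\<Sum>l\<in>I. w l ^ 2)) (reflect I w (2 / (\<Sum>l\<in>I. w l ^ 2)) x) = x"
proof
  fix v
  define s where "s = 2 / (\<Sum>l\<in>I. w l ^ 2)"
  have "s * (\<Sum>l\<in>I. w l ^ 2) = 2" using assms by (simp add: s_def)
  then have "(\<Sum>l\<in>I. w l * reflect I w s x l) = - (\<Sum>l\<in>I. w l * x l)"
    by (simp add: dot_reflect)
  then have "reflect I w s (reflect I w s x) v = reflect I w s x v + s * w v * (\<Sum>l\<in>I. w l * x l)"
    by (simp add: reflect_def[of I w s "reflect I w s x"])
  then show "reflect I w s (reflect I w s x) v = x v" by (simp add: reflect_def)
qed

section \<open>The resultant under a reflection\<close>

definition system_value ::
  "'v set \<Rightarrow> ('v \<Rightarrow> nat) \<Rightarrow> ('v \<times> 'v monomial \<Rightarrow> complex) \<Rightarrow> ('v \<Rightarrow> complex) \<Rightarrow> 'v \<Rightarrow> complex" where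
  "system_value I d c x i = form_value I (d i) (\<lambda>\<alpha>. c (i, \<alpha>)) x"

lemma has_nontrivial_zero_iff:
  "has_nontrivial_zero I d c \<longleftrightarrow> (\<exists>x. (\<exists>v\<in>I. x v \<noteq> 0) \<and> (\<forall>i\<in>I. system_value I d c x i = 0))"
  by (simp add: has_nontrivial_zero_def system_value_def)

text \<open>The action \<open>F \<mapsto> Q (F (Q x))\<close> of the reflection \<open>Q\<close> on systems of forms. It is stated as a
  relation between values, so that the coefficients of a substituted form never have to be written
  down.\<close>
definition reflected_system ::
  "'v set \<Rightarrow> ('v \<Rightarrow> nat) \<Rightarrow> ('v \<Rightarrow> complex) \<Rightarrow> ('v \<times> 'v monomial \<Rightarrow> complex) \<Rightarrow>
     ('v \<times> 'v monomial \<Rightarrow> complex) \<Rightarrow> bool" where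
  "reflected_system I d w c c' \<longleftrightarrow>
     (let s = 2 / (\<Sum>l\<in>I. w l ^ 2) in
      \<forall>x. \<forall>i\<in>I. system_value I d c' x i = reflect I w s (system_value I d c (reflect I w s x)) i)"

lemma poly_eval_int_mpol:
  "poly (eval_int_mpol R c) s = eval_int_mpol R (\<lambda>z. poly (c z) s)"
  by (simp add: eval_int_mpol_def poly_sum poly_prod poly_power)

lemma generic_resultant_cong:
  assumes "is_generic_resultant I d R" "finite I"
    and "\<And>x i. i \<in> I \<Longrightarrow> system_value I d c x i = system_value I d c' x i"
  shows "eval_int_mpol R c = eval_int_mpol R c'"
proof -
  have eq: "c (i, \<alpha>) = c' (i, \<alpha>)" if "i \<in> I" "\<alpha> \<in> monomials_of_degree I (d i)" for i \<alpha>
    using form_value_determines_coefficients[OF assms(2) _ that(2),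
        of "\<lambda>\<alpha>. c (i, \<alpha>)" "\<lambda>\<alpha>. c' (i, \<alpha>)"] assms(3)[OF that(1)]
    by (simp add: system_value_def)
  have "c z = c' z" if "m \<in> Poly_Mapping.keys R" "z \<in> Poly_Mapping.keys m" for m z
    using assms(1) that eq unfolding is_generic_resultant_def by fast
  then show ?thesis by (simp add: eval_int_mpol_def)
qed

lemma generic_resultant_eq_zero_iff:
  assumes "is_generic_resultant I d R"
  shows "eval_int_mpol R c = 0 \<longleftrightarrow> has_nontrivial_zero I d c"
  using assms by (simp add: is_generic_resultant_def)

text \<open>The complement of the root carries the hypothesis, so that the constant polynomials without
  roots are included, with \<open>n = 0\<close>.\<close>
lemma poly_with_one_root:
  fixes p :: "complex poly"
  assumes "\<And>s. s \<noteq> a \<Longrightarrow> poly p s \<noteq> 0"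
  obtains b n where "\<And>s. poly p s = b * (s - a) ^ n"
proof -
  \<comment> \<open>Split off all factors at the root; the cofactor has no root at all and is constant.\<close>
  have "p \<noteq> 0" using assms[of "a + 1"] by auto
  then obtain q where q: "p = [:- a, 1:] ^ order a p * q" "\<not> [:- a, 1:] dvd q"
    using order_decomp by blast
  have "poly q s \<noteq> 0" for s
  proof (cases "s = a")
    case True
    then show ?thesis using q(2) by (simp add: poly_eq_0_iff_dvd)
  next
    case False
    then show ?thesis using assms[of s] q(1) by (metis mult_zero_right poly_mult)
  qed
  then have "constant (poly q)" using fundamental_theorem_of_algebra by blast
  then have const: "poly q s = poly q 0" for s unfolding constant_def by blast
  have "poly p s = poly q 0 * (s - a) ^ order a p" for s
  proof -
    have "poly p s = poly ([:- a, 1:] ^ order a p * q) s" using q(1) by simp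
    also have "\<dots> = (s - a) ^ order a p * poly q s" by (simp add: poly_power)
    finally show ?thesis by (simp only: const[of s] mult.commute)
  qed
  then show ?thesis using that by blast
qed

text \<open>The coefficients of \<open>M\<^sub>s (F (M\<^sub>s x))\<close> are polynomials in \<open>s\<close>. Equations are only mixed where
  \<open>w\<close> is nonzero; since those have equal degrees, the result is again a system of forms of the
  prescribed degrees.\<close>
lemma reflection_path:
  fixes c :: "'v \<times> 'v monomial \<Rightarrow> complex"
  assumes "finite I" and deg: "\<And>i j. i \<in> I \<Longrightarrow> j \<in> I \<Longrightarrow> w i \<noteq> 0 \<Longrightarrow> w j \<noteq> 0 \<Longrightarrow> d i = d j"
  shows "\<exists>P :: 'v \<times> 'v monomial \<Rightarrow> complex poly. \<forall>s x. \<forall>i\<in>I.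
           system_value I d (\<lambda>z. poly (P z) s) x i =
           reflect I w s (system_value I d c (reflect I w s x)) i"
proof -
  define X :: "'v \<Rightarrow> ('v, complex poly) mpol"
    where "X v = mvar v - mconst [:0, w v:] * (\<Sum>l\<in>I. mconst [:w l:] * mvar l)" for v
  define B where "B j = (\<Sum>\<alpha>\<in>monomials_of_degree I (d j).
      mconst [:c (j, \<alpha>):] * (\<Prod>v\<in>I. X v ^ Poly_Mapping.lookup \<alpha> v))" for j
  \<comment> \<open>The sum runs only over equations of the same degree as the \<open>i\<close>-th one, so that \<open>F i\<close> is
    visibly homogeneous.\<close>
  define F where "F i = (if w i = 0 then B i
      else B i - mconst [:0, w i:] * (\<Sum>j\<in>{j\<in>I. w j \<noteq> 0}. mconst [:w j:] * B j))" for i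
  have X: "is_form I 1 (X v)" if "v \<in> I" for v
    unfolding X_def using assms(1) that
    by (intro is_form_diff is_form_mconst_mult is_form_sum is_form_mvar)
  have B: "is_form I (d j) (B j)" for j
    unfolding B_def
  proof (intro is_form_sum is_form_mconst_mult)
    fix \<alpha> assume "\<alpha> \<in> monomials_of_degree I (d j)"
    then have "(\<Sum>v\<in>I. Poly_Mapping.lookup \<alpha> v) = d j" by (simp add: monomials_of_degree_def)
    then show "is_form I (d j) (\<Prod>v\<in>I. X v ^ Poly_Mapping.lookup \<alpha> v)"
      using is_form_prod[OF assms(1), where f = "\<lambda>v. X v ^ Poly_Mapping.lookup \<alpha> v"
          and m = "Poly_Mapping.lookup \<alpha>"]
      by (simp add: is_form_power[OF X])
  qed
  have F: "is_form I (d i) (F i)" if "i \<in> I" for i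
  proof -
    have "is_form I (d i) (B j)" if "j \<in> I" "w j \<noteq> 0" "w i \<noteq> 0" for j
      using B[of j] deg[of i j] that \<open>i \<in> I\<close> by simp
    then show ?thesis
      unfolding F_def by (auto intro!: is_form_diff is_form_mconst_mult is_form_sum B)
  qed
  have valX: "mpol_value I s x (X v) = reflect I w s x v" if "v \<in> I" for s x v
    using that assms(1) by (simp add: X_def reflect_def mult_ac)
  have valB: "mpol_value I s x (B j) = system_value I d c (reflect I w s x) j" for s x j
    by (simp add: B_def system_value_def form_value_def valX)
  have valF: "mpol_value I s x (F i) = reflect I w s (system_value I d c (reflect I w s x)) i"
    for s x i
  proof -
    define g where "g = system_value I d c (reflect I w s x)"
    have "(\<Sum>j\<in>{j\<in>I. w j \<noteq> 0}. w j * g j) = (\<Sum>j\<in>I. w j * g j)"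
      using assms(1) by (intro sum.mono_neutral_left) auto
    moreover have "mpol_value I s x (F i) = (if w i = 0 then g i
        else g i - s * w i * (\<Sum>j\<in>{j\<in>I. w j \<noteq> 0}. w j * g j))"
      by (simp add: F_def valB g_def)
    ultimately show ?thesis by (simp add: reflect_def[of I w s g] flip: g_def)
  qed
  show ?thesis
  proof (intro exI[of _ "\<lambda>(i, \<alpha>). Poly_Mapping.lookup (F i) \<alpha>"] allI ballI)
    fix s x i assume "i \<in> I"
    then show "system_value I d (\<lambda>z. poly (case z of (i, \<alpha>) \<Rightarrow> Poly_Mapping.lookup (F i) \<alpha>) s) x i =
        reflect I w s (system_value I d c (reflect I w s x)) i"
      using form_value_is_form[OF assms(1) F] by (simp add: system_value_def valF)
  qed
qed

text \<open>If \<open>F\<close> has a nontrivial zero, its reflection is a zero of the reflected system, and both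
  resultants vanish. Otherwise consider the path \<open>M\<^sub>s (F (M\<^sub>s x))\<close> whose resultant is a polynomial in \<open>s\<close>. The
  system on the path has no nontrivial zero as long as \<open>M\<^sub>s\<close> is invertible. So the polynomial has at
  most the one root \<open>1 / (w \<bullet> w)\<close>, and its values at the points \<open>0\<close> and \<open>2 / (w \<bullet> w)\<close>, which are
  symmetric about this root, agree up to sign.\<close>
lemma generic_resultant_reflected_up_to_sign:
  fixes c c' :: "'v \<times> 'v monomial \<Rightarrow> complex"
  assumes R: "is_generic_resultant I d R" and fin: "finite I"
    and deg: "\<And>i j. i \<in> I \<Longrightarrow> j \<in> I \<Longrightarrow> w i \<noteq> 0 \<Longrightarrow> w j \<noteq> 0 \<Longrightarrow> d i = d j"
    and w: "(\<Sum>l\<in>I. w l ^ 2) \<noteq> 0" and c': "reflected_system I d w c c'"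
  shows "eval_int_mpol R c' = eval_int_mpol R c \<or> eval_int_mpol R c' = - eval_int_mpol R c"
proof -
  define N where "N = (\<Sum>l\<in>I. w l ^ 2)"
  have N: "N \<noteq> 0" using w by (simp add: N_def)
  have c'_val: "system_value I d c' x i = reflect I w (2 / N) (system_value I d c (reflect I w (2 / N) x)) i"
    if "i \<in> I" for x i
    using c' that by (simp add: reflected_system_def N_def Let_def)
  show ?thesis
  proof (cases "eval_int_mpol R c = 0")
    case True
    then obtain x v where x: "v \<in> I" "x v \<noteq> 0" "\<And>i. i \<in> I \<Longrightarrow> system_value I d c x i = 0"
      using generic_resultant_eq_zero_iff[OF R] by (auto simp: has_nontrivial_zero_iff)
    define y where "y = reflect I w (2 / N) x"
    have y: "reflect I w (2 / N) y = x" using reflect_reflect[OF w] by (simp add: y_def N_def)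
    have "reflect I w (2 / N) (system_value I d c x) i = 0" if "i \<in> I" for i
      using x(3) that by (simp add: reflect_def)
    then have "system_value I d c' y i = 0" if "i \<in> I" for i
      using that by (simp only: c'_val[OF that] y)
    moreover have "\<exists>u\<in>I. y u \<noteq> 0"
    proof (rule ccontr)
      assume "\<not> ?thesis"
      then have "reflect I w (2 / N) y v = 0" using x(1) by (simp add: reflect_def)
      then show False using x(2) y by simp
    qed
    ultimately have "eval_int_mpol R c' = 0"
      using generic_resultant_eq_zero_iff[OF R] by (auto simp: has_nontrivial_zero_iff)
    then show ?thesis using True by simp
  next
    case False
    have "\<exists>P :: 'v \<times> 'v monomial \<Rightarrow> complex poly. \<forall>s x. \<forall>i\<in>I.
        system_value I d (\<lambda>z. poly (P z) s) x i =
        reflect I w s (system_value I d c (reflect I w s x)) i"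
      by (rule reflection_path[OF fin]) (rule deg)
    then obtain P where P: "\<And>s x i. i \<in> I \<Longrightarrow> system_value I d (\<lambda>z. poly (P z) s) x i =
        reflect I w s (system_value I d c (reflect I w s x)) i"
      by blast
    define p where "p = eval_int_mpol R P"
    have p: "poly p s = eval_int_mpol R (\<lambda>z. poly (P z) s)" for s
      by (simp add: p_def poly_eval_int_mpol)
    have "poly p s \<noteq> 0" if "s \<noteq> 1 / N" for s
    proof
      assume "poly p s = 0"
      then have "has_nontrivial_zero I d (\<lambda>z. poly (P z) s)"
        using generic_resultant_eq_zero_iff[OF R] by (simp add: p)
      then obtain x v where x: "v \<in> I" "x v \<noteq> 0"
        and zero: "\<And>i. i \<in> I \<Longrightarrow> system_value I d (\<lambda>z. poly (P z) s) x i = 0"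
        unfolding has_nontrivial_zero_iff by blast
      have reflect_zero: "reflect I w s (system_value I d c (reflect I w s x)) i = 0"
        if "i \<in> I" for i
        using P[OF that, of s x] zero[OF that] by simp
      have s: "s * (\<Sum>l\<in>I. w l ^ 2) \<noteq> 1" using that N by (auto simp: N_def field_simps)
      have "system_value I d c (reflect I w s x) i = 0" if "i \<in> I" for i
        using reflect_eq_zeroD[OF s reflect_zero that] .
      moreover have "\<exists>u\<in>I. reflect I w s x u \<noteq> 0"
        using reflect_eq_zeroD[OF s _ x(1), of x] x(2) by blast
      ultimately show False
        using False generic_resultant_eq_zero_iff[OF R] by (auto simp: has_nontrivial_zero_iff)
    qed
    then obtain b n where b: "\<And>s. poly p s = b * (s - 1 / N) ^ n"
      using poly_with_one_root by metis
    have "eval_int_mpol R c = poly p 0"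
      unfolding p by (rule generic_resultant_cong[OF R fin]) (simp only: P, simp add: reflect_def)
    moreover have "eval_int_mpol R c' = poly p (2 / N)"
      unfolding p by (rule generic_resultant_cong[OF R fin]) (simp only: P c'_val)
    moreover have "2 / N - 1 / N = 1 / N" by (simp add: diff_divide_distrib[symmetric])
    ultimately show ?thesis
      by (cases "even n") (simp_all only: b diff_0 power_minus_even power_minus_odd mult_minus_right minus_minus simp_thms)
  qed
qed

lemma system_value_add_scale:
  "system_value I d (\<lambda>z. c z + u * e z) x i = system_value I d c x i + u * system_value I d e x i"
  by (simp add: system_value_def form_value_def sum.distrib sum_distrib_left algebra_simps)

lemma reflected_system_add_scale:
  assumes "reflected_system I d w c c'" "reflected_system I d w e e'"
  shows "reflected_system I d w (\<lambda>z. c z + u * e z) (\<lambda>z. c' z + u * e' z)"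
proof -
  have refl: "reflect I w s (\<lambda>i. f i + u * g i) i = reflect I w s f i + u * reflect I w s g i"
    for s f g i
    by (simp add: reflect_def sum.distrib sum_distrib_left algebra_simps)
  have val: "system_value I d (\<lambda>z. c z + u * e z) x =
      (\<lambda>i. system_value I d c x i + u * system_value I d e x i)" for c e x
    by (rule ext) (rule system_value_add_scale)
  show ?thesis
    using assms by (simp add: reflected_system_def Let_def val refl)
qed

text \<open>The sign is the same for all systems: on the line from \<open>c\<close> to \<open>e\<close> the two resultants are
  polynomials with equal squares, hence equal or opposite as polynomials. At the system \<open>e\<close>, which
  the reflection fixes and whose resultant is nonzero, they agree, so they are not opposite.\<close>
lemma generic_resultant_reflected:
  fixes c c' e :: "'v \<times> 'v monomial \<Rightarrow> complex"
  assumes R: "is_generic_resultant I d R" and fin: "finite I"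
    and deg: "\<And>i j. i \<in> I \<Longrightarrow> j \<in> I \<Longrightarrow> w i \<noteq> 0 \<Longrightarrow> w j \<noteq> 0 \<Longrightarrow> d i = d j"
    and w: "(\<Sum>l\<in>I. w l ^ 2) \<noteq> 0" and c': "reflected_system I d w c c'"
    and e: "reflected_system I d w e e" "\<not> has_nontrivial_zero I d e"
  shows "eval_int_mpol R c' = eval_int_mpol R c"
proof -
  define p where "p = eval_int_mpol R (\<lambda>z. [:c z, e z - c z:])"
  define p' where "p' = eval_int_mpol R (\<lambda>z. [:c' z, e z - c' z:])"
  have p: "poly p u = eval_int_mpol R (\<lambda>z. c z + u * (e z - c z))" for u
    by (simp add: p_def poly_eval_int_mpol)
  have p': "poly p' u = eval_int_mpol R (\<lambda>z. c' z + u * (e z - c' z))" for u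
    by (simp add: p'_def poly_eval_int_mpol)
  have diff: "reflected_system I d w (\<lambda>z. e z - c z) (\<lambda>z. e z - c' z)"
    using reflected_system_add_scale[OF e(1) c', of "-1"] by simp
  \<comment> \<open>Every point of the line \<open>c + u (e - c)\<close> is mapped to the point \<open>c' + u (e - c')\<close>, as the
    action on systems is linear and fixes \<open>e\<close>.\<close>
  have "(poly p' u - poly p u) * (poly p' u + poly p u) = 0" for u
    unfolding p p'
    using generic_resultant_reflected_up_to_sign[OF R fin deg w
        reflected_system_add_scale[OF c' diff, of u]]
    by (auto simp: algebra_simps)
  then have "(p' - p) * (p' + p) = 0"
    by (subst poly_all_0_iff_0[symmetric]) simp
  then have "p' = p \<or> p' = - p" by (auto simp: add_eq_0_iff2)
  moreover have "poly p' 1 = poly p 1" "poly p 1 \<noteq> 0"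
    using e(2) generic_resultant_eq_zero_iff[OF R] by (simp_all add: p p')
  ultimately have "p' = p" by auto
  then have "poly p' 0 = poly p 0" by simp
  then show ?thesis by (simp add: p p')
qed

text \<open>The coefficients of the system are polynomials in \<open>\<lambda>\<close>; the invariance holds after substituting
  any complex number for \<open>\<lambda>\<close>, hence identically.\<close>
lemma resultant_reflected:
  fixes F F' :: "'v \<Rightarrow> ('v, complex poly) mpol"
  assumes fin: "finite I"
    and deg: "\<And>i j. i \<in> I \<Longrightarrow> j \<in> I \<Longrightarrow> w i \<noteq> 0 \<Longrightarrow> w j \<noteq> 0 \<Longrightarrow> d i = d j"
    and w: "(\<Sum>l\<in>I. w l ^ 2) \<noteq> 0"
    and F: "\<And>i. i \<in> I \<Longrightarrow> is_form I (d i) (F i)"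
    and F': "\<And>i. i \<in> I \<Longrightarrow> is_form I (d i) (F' i)"
    and refl: "\<And>s x i. i \<in> I \<Longrightarrow> mpol_value I s x (F' i) =
      reflect I w (2 / (\<Sum>l\<in>I. w l ^ 2))
        (\<lambda>j. mpol_value I s (reflect I w (2 / (\<Sum>l\<in>I. w l ^ 2)) x) (F j)) i"
    and e: "\<exists>e. reflected_system I d w e e \<and> \<not> has_nontrivial_zero I d e"
  shows "resultant I d F' = resultant I d F"
proof (cases "\<exists>R. is_generic_resultant I d R")
  case True
  define R where "R = (SOME R. is_generic_resultant I d R)"
  have R: "is_generic_resultant I d R" unfolding R_def by (rule someI_ex[OF True])
  obtain e where e: "reflected_system I d w e e" "\<not> has_nontrivial_zero I d e"
    using assms(7) by blast
  have "poly (eval_int_mpol R (\<lambda>(i, \<alpha>). Poly_Mapping.lookup (F' i) \<alpha>)) s =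
        poly (eval_int_mpol R (\<lambda>(i, \<alpha>). Poly_Mapping.lookup (F i) \<alpha>)) s" for s
  proof -
    define c where "c = (\<lambda>(i, \<alpha>). poly (Poly_Mapping.lookup (F i) \<alpha>) s)"
    define c' where "c' = (\<lambda>(i, \<alpha>). poly (Poly_Mapping.lookup (F' i) \<alpha>) s)"
    have val: "system_value I d c x i = mpol_value I s x (F i)"
      "system_value I d c' x i = mpol_value I s x (F' i)" if "i \<in> I" for x i
      using form_value_is_form[OF fin F[OF that]] form_value_is_form[OF fin F'[OF that]]
      by (simp_all add: c_def c'_def system_value_def)
    have "reflected_system I d w c c'"
      unfolding reflected_system_def Let_def
    proof (intro allI ballI)
      fix x i assume i: "i \<in> I"
      show "system_value I d c' x i = reflect I w (2 / (\<Sum>l\<in>I. w l ^ 2))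
          (system_value I d c (reflect I w (2 / (\<Sum>l\<in>I. w l ^ 2)) x)) i"
        unfolding val(2)[OF i] refl[OF i] by (rule reflect_cong[OF _ i]) (simp only: val(1))
    qed
    then have "eval_int_mpol R c' = eval_int_mpol R c"
      by (rule generic_resultant_reflected[OF R fin _ w _ e, rotated]) (rule deg)
    then show ?thesis by (simp add: poly_eval_int_mpol c_def c'_def case_prod_unfold)
  qed
  then have "eval_int_mpol R (\<lambda>(i, \<alpha>). Poly_Mapping.lookup (F' i) \<alpha>) =
      eval_int_mpol R (\<lambda>(i, \<alpha>). Poly_Mapping.lookup (F i) \<alpha>)"
    by (subst poly_eq_poly_eq_iff[symmetric]) (rule ext)
  then show ?thesis using True by (simp add: resultant_def R_def)
next
  case False
  then show ?thesis by (simp add: resultant_def)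
qed

section \<open>Systems fixed by a reflection\<close>

text \<open>The construction of a fixed system without nontrivial zeros. Choose \<open>a\<close> with \<open>w\<^sub>a \<noteq> 0\<close>. The
  vectors \<open>e\<^sub>j - (w\<^sub>j / w\<^sub>a) e\<^sub>a\<close> for \<open>j \<noteq> a\<close> are a basis of the hyperplane orthogonal to \<open>w\<close>, which
  the reflection fixes pointwise. With these vectors as coefficients of the even forms \<open>H j\<close> and \<open>w\<close>
  as coefficient of the odd form \<open>G\<close>, the system \<open>F = G w + (\<Sum>j. H j (e\<^sub>j - (w\<^sub>j / w\<^sub>a) e\<^sub>a))\<close> is fixed:
  composing with the reflection negates \<open>G\<close>, and applying the reflection to the result negates \<open>w\<close>.
  By linear independence a zero of \<open>F\<close> is a common zero of \<open>G\<close> and all these \<open>H j\<close>. The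
  forms are given as polynomials with parameter only so that the evaluation above applies to them;
  the parameter is set to \<open>0\<close>.\<close>
lemma fixed_system_exists:
  fixes G :: "('v, complex poly) mpol" and H :: "'v \<Rightarrow> ('v, complex poly) mpol"
  assumes fin: "finite I"
    and deg: "\<And>i j. i \<in> I \<Longrightarrow> j \<in> I \<Longrightarrow> w i \<noteq> 0 \<Longrightarrow> w j \<noteq> 0 \<Longrightarrow> d i = d j"
    and w: "(\<Sum>l\<in>I. w l ^ 2) \<noteq> 0" and a: "a \<in> I" "w a \<noteq> 0"
    and G: "is_form I (d a) G" and H: "\<And>j. j \<in> I \<Longrightarrow> is_form I (d j) (H j)"
    and oddG: "\<And>x. mpol_value I 0 (reflect I w (2 / (\<Sum>l\<in>I. w l ^ 2)) x) G = - mpol_value I 0 x G"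
    and evenH: "\<And>x j. j \<in> I \<Longrightarrow>
      mpol_value I 0 (reflect I w (2 / (\<Sum>l\<in>I. w l ^ 2)) x) (H j) = mpol_value I 0 x (H j)"
    and zero: "\<And>x i. mpol_value I 0 x G = 0 \<Longrightarrow>
      (\<And>j. j \<in> I \<Longrightarrow> j \<noteq> a \<Longrightarrow> mpol_value I 0 x (H j) = 0) \<Longrightarrow> i \<in> I \<Longrightarrow> x i = 0"
  shows "\<exists>e. reflected_system I d w e e \<and> \<not> has_nontrivial_zero I d e"
proof -
  define N where "N = (\<Sum>l\<in>I. w l ^ 2)"
  have N: "N \<noteq> 0" using w by (simp add: N_def)
  define K where "K i = (if i = a
      then (\<Sum>j\<in>{j\<in>I - {a}. w j \<noteq> 0}. mconst [:- (w j / w a):] * H j) else H i)" for i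
  define F where "F i = (if w i = 0 then K i else mconst [:w i:] * G + K i)" for i
  have Ha: "is_form I (d a) (H j)" if "j \<in> I" "w j \<noteq> 0" for j
    using H[OF that(1)] deg[OF that(1) a(1) that(2) a(2)] by simp
  have K: "is_form I (d i) (K i)" if "i \<in> I" for i
    unfolding K_def using H[OF that] Ha
    by (auto intro!: is_form_sum is_form_mconst_mult)
  have F: "is_form I (d i) (F i)" if "i \<in> I" for i
    unfolding F_def using K[OF that] G deg[OF that a(1) _ a(2)]
    by (auto intro!: is_form_add is_form_mconst_mult)
  define g where "g x = mpol_value I 0 x G" for x
  define h where "h x j = mpol_value I 0 x (H j)" for x j
  define k where "k x i = mpol_value I 0 x (K i)" for x i
  have k_a: "k x a = - (\<Sum>j\<in>I - {a}. w j / w a * h x j)" for x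
  proof -
    have "(\<Sum>j\<in>{j\<in>I - {a}. w j \<noteq> 0}. w j / w a * h x j) = (\<Sum>j\<in>I - {a}. w j / w a * h x j)"
      using fin by (intro sum.mono_neutral_left) auto
    then show ?thesis by (simp add: k_def K_def h_def sum_negf)
  qed
  have k_other: "k x j = h x j" if "j \<noteq> a" for x j using that by (simp add: k_def K_def h_def)
  define f where "f x i = mpol_value I 0 x (F i)" for x i
  have f: "f x i = w i * g x + k x i" for x i by (simp add: f_def F_def g_def k_def)
  \<comment> \<open>The part of the system without \<open>G\<close> takes values in the hyperplane orthogonal to \<open>w\<close>.\<close>
  have dot_k: "(\<Sum>i\<in>I. w i * k x i) = 0" for x
  proof -
    have "(\<Sum>i\<in>I. w i * k x i) = w a * k x a + (\<Sum>i\<in>I - {a}. w i * h x i)"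
      using fin a(1) by (subst sum.remove) (auto simp: k_other)
    also have "w a * k x a = - (\<Sum>j\<in>I - {a}. w j * h x j)"
      using a(2) by (simp add: k_a sum_distrib_left)
    finally show ?thesis by simp
  qed
  have dot_f: "(\<Sum>i\<in>I. w i * f x i) = N * g x" for x
  proof -
    have "(\<Sum>i\<in>I. w i * f x i) = (\<Sum>i\<in>I. w i ^ 2 * g x) + (\<Sum>i\<in>I. w i * k x i)"
      by (simp add: f distrib_left sum.distrib power2_eq_square mult.assoc)
    then show ?thesis by (simp add: dot_k N_def sum_distrib_right)
  qed
  define Q where "Q = reflect I w (2 / N)"
  have gQ: "g (Q x) = - g x" for x using oddG by (simp add: g_def Q_def N_def)
  have hQ: "h (Q x) j = h x j" if "j \<in> I" for x j using evenH[OF that] by (simp add: h_def Q_def N_def)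
  have kQ: "k (Q x) i = k x i" if "i \<in> I" for x i
    using hQ that by (cases "i = a") (simp_all add: k_a k_other)
  have fixed: "f x i = Q (f (Q x)) i" if "i \<in> I" for x i
  proof -
    have "Q (f (Q x)) i = f (Q x) i - 2 / N * w i * (N * g (Q x))"
      by (simp add: Q_def reflect_def[of I w "2 / N" "f _"] dot_f)
    also have "\<dots> = f x i" using N by (simp add: f gQ kQ that)
    finally show ?thesis by simp
  qed
  define e where "e = (\<lambda>(i, \<alpha>). poly (Poly_Mapping.lookup (F i) \<alpha>) 0)"
  have e: "system_value I d e x i = f x i" if "i \<in> I" for x i
    using form_value_is_form[OF fin F[OF that]] by (simp add: e_def system_value_def f_def)
  have "reflected_system I d w e e"
    unfolding reflected_system_def Let_def N_def[symmetric]
  proof (intro allI ballI)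
    fix x i assume i: "i \<in> I"
    have "reflect I w (2 / N) (system_value I d e (reflect I w (2 / N) x)) i = Q (f (Q x)) i"
      unfolding Q_def by (rule reflect_cong[OF _ i]) (rule e)
    then show "system_value I d e x i =
        reflect I w (2 / N) (system_value I d e (reflect I w (2 / N) x)) i"
      using fixed[OF i, of x] e[OF i, of x] by simp
  qed
  moreover have "\<not> has_nontrivial_zero I d e"
  proof
    assume "has_nontrivial_zero I d e"
    then obtain x v where x: "v \<in> I" "x v \<noteq> 0" "\<And>i. i \<in> I \<Longrightarrow> f x i = 0"
      using e by (auto simp: has_nontrivial_zero_iff)
    have "N * g x = 0" using dot_f[of x] x(3) by simp
    then have g: "g x = 0" using N by simp
    have "h x j = 0" if "j \<in> I" "j \<noteq> a" for j
      using x(3)[OF that(1)] that(2) by (simp add: f g k_other)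
    then have "x v = 0" using zero[of x v] g x(1) by (simp add: g_def h_def)
    then show False using x(2) by simp
  qed
  ultimately show ?thesis by blast
qed

text \<open>The linear forms \<open>w \<bullet> x\<close> and \<open>x\<^sub>j - (w\<^sub>j / w\<^sub>a) x\<^sub>a\<close> for \<open>j \<noteq> a\<close> are a system of coordinates.
  The reflection negates the first and fixes the others.\<close>
lemma coordinates_determine_vector:
  assumes "(\<Sum>l\<in>I. w l ^ 2) \<noteq> 0" "w a \<noteq> 0" "(\<Sum>l\<in>I. w l * x l) = 0"
    and "\<And>j. j \<in> I \<Longrightarrow> j \<noteq> a \<Longrightarrow> x j - w j / w a * x a = 0" and "i \<in> I"
  shows "x i = (0 :: complex)"
proof -
  have x: "x j = w j * (x a / w a)" if "j \<in> I" for j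
    using assms(2) assms(4)[OF that] by (cases "j = a") auto
  have "(\<Sum>l\<in>I. w l * x l) = (\<Sum>l\<in>I. w l ^ 2) * (x a / w a)"
    by (simp add: x power2_eq_square sum_distrib_right sum_divide_distrib mult.assoc
        cong: sum.cong)
  then show ?thesis using assms(1,2,3) x[OF assms(5)] by auto
qed

text \<open>Here \<open>G\<close> and \<open>H j\<close> are the \<open>m\<close>-th powers of the coordinates from
  \<open>coordinates_determine_vector\<close>; \<open>G\<close> is odd because \<open>m\<close> is.\<close>
lemma fixed_system_odd_degree:
  fixes I :: "'v set"
  assumes fin: "finite I" and w: "(\<Sum>l\<in>I. w l ^ 2) \<noteq> 0" and m: "odd m"
  shows "\<exists>e. reflected_system I (\<lambda>_. m) w e e \<and> \<not> has_nontrivial_zero I (\<lambda>_. m) e"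
proof -
  obtain a where a: "a \<in> I" "w a \<noteq> 0" using w by (metis (mono_tags) sum.neutral zero_power2)
  define N where "N = (\<Sum>l\<in>I. w l ^ 2)"
  define L :: "('v, complex poly) mpol" where "L = (\<Sum>l\<in>I. mconst [:w l:] * mvar l)"
  define Y :: "'v \<Rightarrow> ('v, complex poly) mpol"
    where "Y j = mvar j - mconst [:w j / w a:] * mvar a" for j
  have L: "is_form I 1 L" unfolding L_def
    using fin by (intro is_form_sum is_form_mconst_mult is_form_mvar)
  have Y: "is_form I 1 (Y j)" if "j \<in> I" for j unfolding Y_def
    using fin a that by (intro is_form_diff is_form_mconst_mult is_form_mvar)
  have valL: "mpol_value I s x L = (\<Sum>l\<in>I. w l * x l)" for s x using fin by (simp add: L_def)
  have valY: "mpol_value I s x (Y j) = x j - w j / w a * x a" if "j \<in> I" for s x j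
    using fin a(1) that by (simp add: Y_def)
  have refl: "(\<Sum>l\<in>I. w l * reflect I w (2 / N) x l) = - (\<Sum>l\<in>I. w l * x l)" for x
    using w by (simp add: dot_reflect N_def)
  show ?thesis
  proof (rule fixed_system_exists[OF fin _ w a, where G = "L ^ m" and H = "\<lambda>j. Y j ^ m"])
    show "is_form I m (L ^ m)" "\<And>j. j \<in> I \<Longrightarrow> is_form I m (Y j ^ m)"
      by (auto intro: is_form_power L Y)
    show "mpol_value I 0 (reflect I w (2 / (\<Sum>l\<in>I. w l ^ 2)) x) (L ^ m) = - mpol_value I 0 x (L ^ m)"
      for x using m by (simp add: valL refl flip: N_def)
    show "mpol_value I 0 (reflect I w (2 / (\<Sum>l\<in>I. w l ^ 2)) x) (Y j ^ m) = mpol_value I 0 x (Y j ^ m)"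
      if "j \<in> I" for x j
      using a that by (simp add: valY reflect_def field_simps)
    show "x i = 0" if "mpol_value I 0 x (L ^ m) = 0"
      "\<And>j. j \<in> I \<Longrightarrow> j \<noteq> a \<Longrightarrow> mpol_value I 0 x (Y j ^ m) = 0" "i \<in> I" for x i
    proof (rule coordinates_determine_vector[OF w a(2) _ _ that(3)])
      show "(\<Sum>l\<in>I. w l * x l) = 0" using that(1) m by (auto simp: valL)
      show "x j - w j / w a * x a = 0" if "j \<in> I" "j \<noteq> a" for j
        using \<open>\<And>j. j \<in> I \<Longrightarrow> j \<noteq> a \<Longrightarrow> mpol_value I 0 x (Y j ^ m) = 0\<close>[OF that] that(1)
        by (simp add: valY)
    qed
  qed simp
qed

text \<open>For even \<open>m\<close> the power \<open>(w \<bullet> x)\<^sup>m\<close> would be an even form. The fixed variable \<open>x\<^sub>b\<close> repairs this: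
  \<open>G = (w \<bullet> x) x\<^sub>b\<^bsup>m - 1\<^esup>\<close> is odd, and the quadratic form \<open>(w \<bullet> x)\<^sup>2 - x\<^sub>b\<^sup>2\<close> in place of a power
  of \<open>x\<^sub>b\<close> forces both factors of \<open>G\<close> to vanish as soon as one does.\<close>
lemma fixed_system_even_degree:
  fixes I :: "'v set"
  assumes fin: "finite I" and w: "(\<Sum>l\<in>I. w l ^ 2) \<noteq> 0" and b: "b \<in> I" "w b = 0"
    and m: "even m" "m \<noteq> 0" and d: "d b = 2" "\<And>i. i \<in> I \<Longrightarrow> i \<noteq> b \<Longrightarrow> d i = m"
  shows "\<exists>e. reflected_system I d w e e \<and> \<not> has_nontrivial_zero I d e"
proof -
  obtain a where a: "a \<in> I" "w a \<noteq> 0" using w by (metis (mono_tags) sum.neutral zero_power2)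
  then have ab: "a \<noteq> b" using b by auto
  define N where "N = (\<Sum>l\<in>I. w l ^ 2)"
  define L :: "('v, complex poly) mpol" where "L = (\<Sum>l\<in>I. mconst [:w l:] * mvar l)"
  define H :: "'v \<Rightarrow> ('v, complex poly) mpol" where "H j = (if j = b then L ^ 2 - mvar b ^ 2
      else (mvar j - mconst [:w j / w a:] * mvar a) ^ m)" for j
  have L: "is_form I 1 L" unfolding L_def
    using fin by (intro is_form_sum is_form_mconst_mult is_form_mvar)
  have H: "is_form I (d j) (H j)" if "j \<in> I" for j
  proof (cases "j = b")
    case True
    then show ?thesis using fin b L d(1) unfolding H_def
      by (auto intro!: is_form_diff is_form_power[where m = 1] is_form_mvar)
  next
    case False
    have "is_form I 1 (mvar j - mconst [:w j / w a:] * mvar a :: ('v, complex poly) mpol)"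
      using fin a that by (intro is_form_diff is_form_mconst_mult is_form_mvar)
    then have "is_form I m ((mvar j - mconst [:w j / w a:] * mvar a) ^ m :: ('v, complex poly) mpol)"
      by (rule is_form_power) simp
    then show ?thesis using False d(2)[OF that] by (simp add: H_def)
  qed
  have valL: "mpol_value I s x L = (\<Sum>l\<in>I. w l * x l)" for s x using fin by (simp add: L_def)
  have valH: "mpol_value I s x (H j) = (if j = b then (\<Sum>l\<in>I. w l * x l) ^ 2 - x b ^ 2
      else (x j - w j / w a * x a) ^ m)" if "j \<in> I" for s x j
    using fin a(1) b that by (simp add: H_def valL)
  have valG: "mpol_value I s x (L * mvar b ^ (m - 1)) = (\<Sum>l\<in>I. w l * x l) * x b ^ (m - 1)" for s x
    using fin b by (simp add: valL)
  have refl: "(\<Sum>l\<in>I. w l * reflect I w (2 / N) x l) = - (\<Sum>l\<in>I. w l * x l)" for x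
    using w by (simp add: dot_reflect N_def)
  have refl_b: "reflect I w s x b = x b" for s x using b by (simp add: reflect_def)
  have refl_Y: "reflect I w s x j - w j / w a * reflect I w s x a = x j - w j / w a * x a" for s x j
    using a by (simp add: reflect_def field_simps)
  show ?thesis
  proof (rule fixed_system_exists[OF fin _ w a, where G = "L * mvar b ^ (m - 1)" and H = H])
    show "d i = d j" if "i \<in> I" "j \<in> I" "w i \<noteq> 0" "w j \<noteq> 0" for i j
      using that d(2) b by metis
    have "is_form I m (L * mvar b ^ (m - 1))"
      by (rule is_form_mult[OF L is_form_power[OF is_form_mvar]]) (use fin b m in auto)
    then show "is_form I (d a) (L * mvar b ^ (m - 1))" using d(2)[OF a(1) ab] by simp
    show "is_form I (d j) (H j)" if "j \<in> I" for j by (rule H[OF that])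
    show "mpol_value I 0 (reflect I w (2 / (\<Sum>l\<in>I. w l ^ 2)) x) (L * mvar b ^ (m - 1)) =
        - mpol_value I 0 x (L * mvar b ^ (m - 1))" for x
      by (simp only: valG refl refl_b mult_minus_left flip: N_def)
    show "mpol_value I 0 (reflect I w (2 / (\<Sum>l\<in>I. w l ^ 2)) x) (H j) = mpol_value I 0 x (H j)"
      if "j \<in> I" for x j
      by (simp only: valH[OF that] refl refl_b refl_Y power2_minus flip: N_def)
    show "x i = 0" if "mpol_value I 0 x (L * mvar b ^ (m - 1)) = 0"
      and zero: "\<And>j. j \<in> I \<Longrightarrow> j \<noteq> a \<Longrightarrow> mpol_value I 0 x (H j) = 0" and "i \<in> I" for x i
    proof -
      have "(\<Sum>l\<in>I. w l * x l) ^ 2 = x b ^ 2" using zero[OF b(1)] ab valH[OF b(1)] by simp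
      then have *: "(\<Sum>l\<in>I. w l * x l) = 0" "x b = 0"
        using that(1) unfolding valG by auto
      show ?thesis
      proof (rule coordinates_determine_vector[OF w a(2) *(1) _ \<open>i \<in> I\<close>])
        show "x j - w j / w a * x a = 0" if "j \<in> I" "j \<noteq> a" for j
          using zero[OF that] *(2) b(2) m by (cases "j = b") (auto simp: valH[OF that(1)])
      qed
    qed
  qed
qed

section \<open>E-characteristic polynomials of reflected tensors\<close>

lemma is_form_tensor_apply:
  assumes "\<And>j. j \<in> V \<Longrightarrow> is_form I 1 (X j)"
  shows "is_form I (k - 1) (tensor_apply V k (\<lambda>is. mconst [:A is:]) X i)"
  unfolding tensor_apply_def
proof (intro is_form_sum is_form_mconst_mult)
  fix js assume "js \<in> {js. set js \<subseteq> V \<and> length js = k - 1}"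
  then show "is_form I (k - 1) (\<Prod>j\<leftarrow>js. X j)"
    using is_form_prod_list[of "map X js" I] assms by auto
qed

lemma mpol_value_tensor_apply:
  assumes "\<And>j. j \<in> V \<Longrightarrow> mpol_value I s x (X j) = y j"
  shows "mpol_value I s x (tensor_apply V k (\<lambda>is. mconst [:A is:]) X i) = tensor_apply V k A y i"
proof -
  have "(\<Prod>j\<leftarrow>js. mpol_value I s x (X j)) = (\<Prod>j\<leftarrow>js. y j)" if "set js \<subseteq> V" for js
    using that assms by (intro arg_cong[of _ _ prod_list] map_cong) auto
  then show ?thesis by (simp add: tensor_apply_def comp_def)
qed

lemma is_form_E_system_even:
  assumes "finite V" "i \<in> V" "even k" "k \<ge> 2"
  shows "is_form V (k - 1) (E_system_even V k A i)"
proof -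
  have "is_form V 2 ((mvar j :: ('a, complex poly) mpol) ^ 2)" if "j \<in> V" for j
    by (rule is_form_power[OF is_form_mvar[OF assms(1) that]]) simp
  then have "is_form V 2 (\<Sum>j\<in>V. (mvar j :: ('a, complex poly) mpol) ^ 2)"
    by (rule is_form_sum)
  then have "is_form V (k - 2) ((\<Sum>j\<in>V. (mvar j :: ('a, complex poly) mpol) ^ 2) ^ ((k - 2) div 2))"
    by (rule is_form_power) (use assms(3,4) in auto)
  then have "is_form V (k - 2) (mconst [:0, 1:] *
      (\<Sum>j\<in>V. (mvar j :: ('a, complex poly) mpol) ^ 2) ^ ((k - 2) div 2))"
    by (rule is_form_mconst_mult)
  then have "is_form V (k - 1) (mconst [:0, 1:] *
      (\<Sum>j\<in>V. (mvar j :: ('a, complex poly) mpol) ^ 2) ^ ((k - 2) div 2) * mvar i)"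
    by (rule is_form_mult[OF _ is_form_mvar[OF assms(1,2)]]) (use assms(4) in auto)
  then show ?thesis
    unfolding E_system_even_def
    by (intro is_form_diff is_form_tensor_apply is_form_mvar[OF assms(1)])
qed

lemma mpol_value_E_system_even:
  assumes "finite V" "i \<in> V"
  shows "mpol_value V s x (E_system_even V k A i) =
    tensor_apply V k A x i - s * (\<Sum>j\<in>V. x j ^ 2) ^ ((k - 2) div 2) * x i"
  using assms by (simp add: E_system_even_def mpol_value_tensor_apply[where y = x])

lemma is_form_E_system_odd:
  assumes "finite V" "j \<in> insert None (Some ` V)" "k \<ge> 2"
  shows "is_form (insert None (Some ` V)) (case_option 2 (\<lambda>_. k - 1) j) (E_system_odd V k A j)"
proof -
  let ?I = "insert None (Some ` V)"
  have X: "is_form ?I 1 (mvar v :: ('a option, complex poly) mpol)" if "v \<in> ?I" for v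
    using assms(1) that by (intro is_form_mvar) auto
  show ?thesis
  proof (cases j)
    case None
    have "is_form ?I 2 ((mvar v :: ('a option, complex poly) mpol) ^ 2)" if "v \<in> ?I" for v
      by (rule is_form_power[OF X[OF that]]) simp
    then show ?thesis using None by (auto intro!: is_form_diff is_form_sum)
  next
    case (Some i)
    have "is_form ?I (k - 2) ((mvar None :: ('a option, complex poly) mpol) ^ (k - 2))"
      by (rule is_form_power[OF X]) auto
    then have "is_form ?I (k - 2) (mconst [:0, 1:] * (mvar None :: ('a option, complex poly) mpol) ^ (k - 2))"
      by (rule is_form_mconst_mult)
    then have "is_form ?I (k - 1)
        (mconst [:0, 1:] * (mvar None :: ('a option, complex poly) mpol) ^ (k - 2) * mvar (Some i))"
      by (rule is_form_mult[OF _ X]) (use assms Some in auto)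
    moreover have "is_form ?I (k - 1) (tensor_apply V k (\<lambda>is. mconst [:A is:])
        (\<lambda>j. mvar (Some j) :: ('a option, complex poly) mpol) i)"
      by (rule is_form_tensor_apply) (use X in auto)
    ultimately show ?thesis using Some by (auto intro: is_form_diff)
  qed
qed

lemma mpol_value_E_system_odd:
  assumes "finite V"
  shows "i \<in> V \<Longrightarrow> mpol_value (insert None (Some ` V)) s x (E_system_odd V k A (Some i)) =
      tensor_apply V k A (\<lambda>j. x (Some j)) i - s * x None ^ (k - 2) * x (Some i)"
    and "mpol_value (insert None (Some ` V)) s x (E_system_odd V k A None) =
      (\<Sum>j\<in>V. x (Some j) ^ 2) - x None ^ 2"
  using assms by (simp_all add: mpol_value_tensor_apply[where y = "\<lambda>j. x (Some j)"])

lemma reflect_self_adjoint: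
  "(\<Sum>l\<in>I. reflect I w s x l * y l) = (\<Sum>l\<in>I. x l * reflect I w s y l)"
proof -
  have "(\<Sum>l\<in>I. reflect I w s x l * y l) =
      (\<Sum>l\<in>I. x l * y l) - s * (\<Sum>l\<in>I. w l * x l) * (\<Sum>l\<in>I. w l * y l)" for x y
  proof -
    have "(\<Sum>l\<in>I. reflect I w s x l * y l) =
        (\<Sum>l\<in>I. x l * y l) - (\<Sum>l\<in>I. s * (\<Sum>l\<in>I. w l * x l) * (w l * y l))"
      by (simp add: reflect_def left_diff_distrib right_diff_distrib sum_subtractf mult_ac)
    then show ?thesis by (simp only: sum_distrib_left)
  qed
  note * = this
  have "(\<Sum>l\<in>I. x l * reflect I w s y l) = (\<Sum>l\<in>I. reflect I w s y l * x l)"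
    by (simp add: mult.commute)
  then show ?thesis unfolding * by (simp add: mult_ac)
qed

lemma sum_squares_reflect:
  assumes "(\<Sum>l\<in>I. w l ^ 2) \<noteq> 0"
  shows "(\<Sum>l\<in>I. reflect I w (2 / (\<Sum>l\<in>I. w l ^ 2)) x l ^ 2) = (\<Sum>l\<in>I. x l ^ 2)"
  by (simp only: power2_eq_square[of "reflect _ _ _ _ _"] reflect_self_adjoint reflect_reflect[OF assms])
     (simp add: power2_eq_square)

lemma reflect_diff_scale:
  "reflect I w s (\<lambda>j. f j - u * g j) i = reflect I w s f i - u * reflect I w s g i"
  by (simp add: reflect_def right_diff_distrib left_diff_distrib sum_subtractf sum_distrib_left mult_ac)

lemma reflect_option:
  assumes "finite V"
  shows "reflect (insert None (Some ` V)) (case_option 0 w) s x (Some i) =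
      reflect V w s (\<lambda>j. x (Some j)) i"
    and "reflect (insert None (Some ` V)) (case_option 0 w) s x None = x None"
  using assms by (simp_all add: reflect_def sum.reindex)

text \<open>The hypothesis says that \<open>B\<close> is the tensor \<open>A\<close> in reflected coordinates. The remaining terms
  \<open>\<lambda> (x \<bullet> x)\<^sup>r x\<close> and \<open>x \<bullet> x - \<beta>\<^sup>2\<close> keep their form in these coordinates because a reflection is
  orthogonal, so the whole E-system of \<open>B\<close> is the reflected E-system of \<open>A\<close>. For odd \<open>k\<close> the
  reflection is extended by the identity on the variable \<open>\<beta>\<close>.\<close>
lemma E_charpoly_reflected:
  assumes fin: "finite V" and k: "k \<ge> 2" and w: "(\<Sum>l\<in>V. w l ^ 2) \<noteq> 0"
    and refl: "\<And>x i. i \<in> V \<Longrightarrow> tensor_apply V k B x i =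
      reflect V w (2 / (\<Sum>l\<in>V. w l ^ 2))
        (tensor_apply V k A (reflect V w (2 / (\<Sum>l\<in>V. w l ^ 2)) x)) i"
  shows "E_charpoly V k B = E_charpoly V k A"
proof (cases "even k")
  case True
  define Q where "Q = reflect V w (2 / (\<Sum>l\<in>V. w l ^ 2))"
  have Q: "(\<Sum>l\<in>V. Q x l ^ 2) = (\<Sum>l\<in>V. x l ^ 2)" "Q (Q x) = x" for x
    unfolding Q_def by (rule sum_squares_reflect[OF w], rule reflect_reflect[OF w])
  have "resultant V (\<lambda>_. k - 1) (E_system_even V k B) = resultant V (\<lambda>_. k - 1) (E_system_even V k A)"
  proof (rule resultant_reflected[OF fin _ w])
    fix s :: complex and x i assume i: "i \<in> V"
    define r where "r = s * (\<Sum>j\<in>V. x j ^ 2) ^ ((k - 2) div 2)"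
    have "Q (\<lambda>j. mpol_value V s (Q x) (E_system_even V k A j)) i =
        Q (\<lambda>j. tensor_apply V k A (Q x) j - r * Q x j) i"
      unfolding Q_def
      by (rule reflect_cong[OF _ i]) (simp add: mpol_value_E_system_even[OF fin] Q r_def flip: Q_def)
    also have "\<dots> = Q (tensor_apply V k A (Q x)) i - r * Q (Q x) i"
      unfolding Q_def by (rule reflect_diff_scale)
    also have "\<dots> = mpol_value V s x (E_system_even V k B i)"
      using refl[OF i, of x] by (simp add: mpol_value_E_system_even[OF fin i] Q r_def flip: Q_def)
    finally show "mpol_value V s x (E_system_even V k B i) =
        reflect V w (2 / (\<Sum>l\<in>V. w l ^ 2))
          (\<lambda>j. mpol_value V s (reflect V w (2 / (\<Sum>l\<in>V. w l ^ 2)) x) (E_system_even V k A j)) i"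
      by (simp flip: Q_def)
  next
    show "\<exists>e. reflected_system V (\<lambda>_. k - 1) w e e \<and> \<not> has_nontrivial_zero V (\<lambda>_. k - 1) e"
      by (rule fixed_system_odd_degree[OF fin w]) (use True k in auto)
  qed (simp, (rule is_form_E_system_even[OF fin _ True k], assumption)+)
  then show ?thesis using True by (simp add: E_charpoly_def)
next
  case False
  define I where "I = insert None (Some ` V)"
  define w' where "w' = case_option 0 w"
  define d where "d = case_option 2 (\<lambda>_ :: 'a. k - 1)"
  have finI: "finite I" using fin by (simp add: I_def)
  have w'_sum: "(\<Sum>l\<in>I. w' l ^ 2) = (\<Sum>l\<in>V. w l ^ 2)"
    using fin by (simp add: I_def w'_def sum.reindex)
  define Q where "Q = reflect V w (2 / (\<Sum>l\<in>V. w l ^ 2))"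
  define Q' where "Q' = reflect I w' (2 / (\<Sum>l\<in>I. w' l ^ 2))"
  have Q: "(\<Sum>l\<in>V. Q x l ^ 2) = (\<Sum>l\<in>V. x l ^ 2)" "Q (Q x) = x" for x
    unfolding Q_def by (rule sum_squares_reflect[OF w], rule reflect_reflect[OF w])
  have Q': "Q' x (Some i) = Q (\<lambda>j. x (Some j)) i" "Q' x None = x None" for x i
    unfolding Q'_def w'_sum Q_def by (simp_all add: I_def w'_def reflect_option[OF fin])
  have "resultant I d (E_system_odd V k B) = resultant I d (E_system_odd V k A)"
  proof (rule resultant_reflected[OF finI])
    show "d i = d j" if "w' i \<noteq> 0" "w' j \<noteq> 0" for i j
      using that by (auto simp: w'_def d_def split: option.splits)
    show w': "(\<Sum>l\<in>I. w' l ^ 2) \<noteq> 0" using w by (simp add: w'_sum)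
    show "is_form I (d i) (E_system_odd V k A i)" "is_form I (d i) (E_system_odd V k B i)"
      if "i \<in> I" for i
      unfolding I_def d_def by (rule is_form_E_system_odd[OF fin that[unfolded I_def] k])+
    show "\<exists>e. reflected_system I d w' e e \<and> \<not> has_nontrivial_zero I d e"
      by (rule fixed_system_even_degree[OF finI w', where b = None and m = "k - 1"])
         (use False k in \<open>auto simp: I_def d_def w'_def\<close>)
  next
    fix s :: complex and x i assume i: "i \<in> I"
    define f where "f = (\<lambda>j. mpol_value I s (Q' x) (E_system_odd V k A j))"
    have "mpol_value I s x (E_system_odd V k B i) = Q' f i"
    proof (cases i)
      case None
      have "Q' f None = (\<Sum>j\<in>V. Q (\<lambda>j. x (Some j)) j ^ 2) - x None ^ 2"
        unfolding Q'(2) f_def I_def mpol_value_E_system_odd(2)[OF fin] Q' ..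
      then show ?thesis
        using None by (simp only: Q I_def mpol_value_E_system_odd(2)[OF fin])
    next
      case (Some v)
      then have v: "v \<in> V" using i by (auto simp: I_def)
      define y where "y = (\<lambda>j. x (Some j))"
      define r where "r = s * x None ^ (k - 2)"
      have "Q' f (Some v) = Q (\<lambda>j. f (Some j)) v" by (rule Q')
      also have "\<dots> = Q (\<lambda>j. tensor_apply V k A (Q y) j - r * Q y j) v"
        unfolding Q_def
        by (rule reflect_cong[OF _ v])
           (simp only: f_def I_def mpol_value_E_system_odd(1)[OF fin] Q' y_def r_def flip: Q_def)
      also have "\<dots> = Q (tensor_apply V k A (Q y)) v - r * Q (Q y) v"
        unfolding Q_def by (rule reflect_diff_scale)
      also have "\<dots> = tensor_apply V k B y v - r * y v"
        using refl[OF v, of y] by (simp add: Q(2) flip: Q_def)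
      also have "\<dots> = mpol_value I s x (E_system_odd V k B (Some v))"
        by (simp only: I_def mpol_value_E_system_odd(1)[OF fin v] y_def r_def)
      finally show ?thesis using Some by simp
    qed
    then show "mpol_value I s x (E_system_odd V k B i) = reflect I w' (2 / (\<Sum>l\<in>I. w' l ^ 2))
        (\<lambda>j. mpol_value I s (reflect I w' (2 / (\<Sum>l\<in>I. w' l ^ 2)) x) (E_system_odd V k A j)) i"
      by (simp only: Q'_def f_def)
  qed
  then show ?thesis using False by (simp add: E_charpoly_def I_def d_def)
qed

section \<open>Adjacency tensors of hypergraphs with a sparse vertex set\<close>

text \<open>Only injective lists contribute, and each \<open>(k - 1)\<close>-set is listed in \<open>(k - 1)!\<close> ways, which
  the normalisation of the tensor cancels.\<close>
lemma adjacency_tensor_apply: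
  assumes "uniform_hypergraph k V E"
  shows "tensor_apply V k (adjacency_tensor k E) x i =
    (\<Sum>S\<in>{S. S \<subseteq> V \<and> card S = k - 1 \<and> insert i S \<in> E}. \<Prod>j\<in>S. x j)"
proof -
  have fin: "finite V" and E: "\<And>e. e \<in> E \<Longrightarrow> card e = k"
    using assms by (auto simp: uniform_hypergraph_def)
  define J where "J = {js. set js \<subseteq> V \<and> length js = k - 1}"
  define J' where "J' = {js \<in> J. insert i (set js) \<in> E}"
  define \<S> where "\<S> = {S. S \<subseteq> V \<and> card S = k - 1 \<and> insert i S \<in> E}"
  have J: "finite J" using fin by (simp add: J_def finite_lists_length_eq)
  have \<S>: "finite \<S>" using fin by (auto simp: \<S>_def intro: finite_subset[of _ "Pow V"])
  have distinct: "distinct js" if "js \<in> J'" for js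
  proof -
    have "k = card (insert i (set js))" using E that by (simp add: J'_def)
    then have "k \<le> Suc (card (set js))" by (simp add: card_insert_if)
    then have "length js \<le> card (set js)" using that by (simp add: J'_def J_def)
    then show ?thesis using card_length[of js] by (simp add: card_distinct)
  qed
  have "tensor_apply V k (adjacency_tensor k E) x i =
      (\<Sum>js\<in>J. if insert i (set js) \<in> E then 1 / fact (k - 1) * (\<Prod>j\<leftarrow>js. x j) else 0)"
    unfolding tensor_apply_def J_def[symmetric]
    by (intro sum.cong) (auto simp: adjacency_tensor_def)
  also have "\<dots> = (\<Sum>js\<in>J'. 1 / fact (k - 1) * (\<Prod>j\<leftarrow>js. x j))"
    unfolding J'_def using J by (rule sum.inter_filter[symmetric])
  also have "\<dots> = (\<Sum>js\<in>J'. 1 / fact (k - 1) * (\<Prod>j\<in>set js. x j))"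
    using distinct by (intro sum.cong) (auto simp: prod.distinct_set_conv_list)
  also have "\<dots> = (\<Sum>S\<in>\<S>. \<Sum>js\<in>{js \<in> J'. set js = S}. 1 / fact (k - 1) * (\<Prod>j\<in>set js. x j))"
  proof (rule sum.group[symmetric])
    show "finite J'" using J by (simp add: J'_def)
    show "set ` J' \<subseteq> \<S>"
      using distinct by (auto simp: J'_def J_def \<S>_def distinct_card)
  qed (rule \<S>)
  also have "\<dots> = (\<Sum>S\<in>\<S>. \<Prod>j\<in>S. x j)"
  proof (rule sum.cong[OF refl])
    fix S assume S: "S \<in> \<S>"
    then have finS: "finite S" using fin by (auto simp: \<S>_def intro: finite_subset)
    have "{js \<in> J'. set js = S} = permutations_of_set S"
      using S distinct
      by (auto simp: J'_def J_def \<S>_def permutations_of_set_def distinct_card)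
    then have "card {js \<in> J'. set js = S} = fact (k - 1)"
      using S finS by (simp add: \<S>_def)
    moreover have "(\<Sum>js\<in>{js \<in> J'. set js = S}. 1 / fact (k - 1) * (\<Prod>j\<in>set js. x j)) =
        (\<Sum>js\<in>{js \<in> J'. set js = S}. 1 / fact (k - 1) * (\<Prod>j\<in>S. x j))"
      by (intro sum.cong) auto
    ultimately show "(\<Sum>js\<in>{js \<in> J'. set js = S}. 1 / fact (k - 1) * (\<Prod>j\<in>set js. x j)) =
        (\<Prod>j\<in>S. x j)"
      by simp
  qed
  finally show ?thesis by (simp add: \<S>_def)
qed

text \<open>The complex-valued indicator of the neighbourhood of \<open>S\<close>: a vector indexed by the vertices
  \<open>u\<close>, to which a reflection can be applied.\<close>
definition adj :: "'a set set \<Rightarrow> 'a set \<Rightarrow> 'a \<Rightarrow> complex" where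
  "adj E S u = of_bool (insert u S \<in> E)"

text \<open>The conditions common to a hypergraph and its switched version.\<close>
locale sparse_hypergraph =
  fixes k :: nat and V C D :: "'a set" and E :: "'a set set"
  assumes k: "k \<ge> 2" and uniform: "uniform_hypergraph k V E"
    and V: "V = C \<union> D" and disjoint: "C \<inter> D = {}"
    and sparse: "\<And>e. e \<in> E \<Longrightarrow> card (e \<inter> C) \<le> 1"
begin

lemma finite_sets: "finite V" "finite C" "finite D"
  using uniform V by (auto simp: uniform_hypergraph_def)

lemma finite_subsets: "finite {S. S \<subseteq> D \<and> P S}"
  using finite_sets by (auto intro: finite_subset[of _ "Pow D"])

lemma not_mem_link: "insert i S \<in> E \<Longrightarrow> card S = k - 1 \<Longrightarrow> i \<notin> S"
  using uniform k by (auto simp: uniform_hypergraph_def insert_absorb)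

text \<open>An edge through \<open>i \<in> C\<close> has all its other vertices in \<open>D\<close>, so the component at \<open>i\<close> does not
  involve the variables in \<open>C\<close>.\<close>
lemma tensor_apply_at_C:
  assumes "i \<in> C"
  shows "tensor_apply V k (adjacency_tensor k E) x i =
    (\<Sum>S\<in>{S. S \<subseteq> D \<and> card S = k - 1}. adj E S i * (\<Prod>j\<in>S. x j))"
proof -
  have "S \<subseteq> D" if S: "S \<subseteq> V" "card S = k - 1" "insert i S \<in> E" for S
  proof
    fix v assume v: "v \<in> S"
    show "v \<in> D"
    proof (rule ccontr)
      assume "v \<notin> D"
      then have "{i, v} \<subseteq> insert i S \<inter> C" using S(1) v assms V by auto
      then have "card {i, v} \<le> card (insert i S \<inter> C)"
        using finite_sets by (intro card_mono) auto
      moreover have "i \<noteq> v" using not_mem_link[OF S(3,2)] v by auto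
      ultimately show False using sparse[OF S(3)] by simp
    qed
  qed
  then have "{S. S \<subseteq> V \<and> card S = k - 1 \<and> insert i S \<in> E} =
      {S \<in> {S. S \<subseteq> D \<and> card S = k - 1}. insert i S \<in> E}"
    using V by auto
  then have "tensor_apply V k (adjacency_tensor k E) x i =
      (\<Sum>S\<in>{S. S \<subseteq> D \<and> card S = k - 1}. if insert i S \<in> E then \<Prod>j\<in>S. x j else 0)"
    using finite_subsets
    by (simp only: adjacency_tensor_apply[OF uniform] sum.inter_filter)
  also have "\<dots> = (\<Sum>S\<in>{S. S \<subseteq> D \<and> card S = k - 1}. adj E S i * (\<Prod>j\<in>S. x j))"
    by (intro sum.cong) (auto simp: adj_def)
  finally show ?thesis .
qed

text \<open>An edge through \<open>i \<in> D\<close> lies inside \<open>D\<close> or has exactly one vertex \<open>u\<close> in \<open>C\<close>, so the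
  component at \<open>i\<close> is affine in the variables in \<open>C\<close>, with coefficient vectors \<open>adj E (insert i S)\<close>.\<close>
lemma tensor_apply_at_D:
  assumes "i \<in> D"
  shows "tensor_apply V k (adjacency_tensor k E) x i =
    (\<Sum>S\<in>{S. S \<subseteq> D \<and> card S = k - 1}. adj E S i * (\<Prod>j\<in>S. x j)) +
    (\<Sum>S\<in>{S. S \<subseteq> D \<and> card S = k - 2 \<and> i \<notin> S}.
       (\<Prod>j\<in>S. x j) * (\<Sum>u\<in>C. adj E (insert i S) u * x u))"
proof -
  define \<A> where "\<A> = {S \<in> {S. S \<subseteq> D \<and> card S = k - 1}. insert i S \<in> E}"
  define \<B> where "\<B> = {S. S \<subseteq> V \<and> card S = k - 1 \<and> insert i S \<in> E \<and> \<not> S \<subseteq> D}"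
  define \<T> where "\<T> = {S. S \<subseteq> D \<and> card S = k - 2 \<and> i \<notin> S}"
  have fin: "finite \<A>" "finite \<B>" "finite \<T>"
    using finite_subsets finite_sets
    by (auto simp: \<A>_def \<B>_def \<T>_def intro: finite_subset[of _ "Pow V"])
  have "{S. S \<subseteq> V \<and> card S = k - 1 \<and> insert i S \<in> E} = \<A> \<union> \<B>"
    using V by (auto simp: \<A>_def \<B>_def)
  moreover have "\<A> \<inter> \<B> = {}" by (auto simp: \<A>_def \<B>_def)
  ultimately have split: "tensor_apply V k (adjacency_tensor k E) x i =
      (\<Sum>S\<in>\<A>. \<Prod>j\<in>S. x j) + (\<Sum>S\<in>\<B>. \<Prod>j\<in>S. x j)"
    using fin by (simp add: adjacency_tensor_apply[OF uniform] sum.union_disjoint)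
  have "(\<Sum>S\<in>\<A>. \<Prod>j\<in>S. x j) =
      (\<Sum>S\<in>{S. S \<subseteq> D \<and> card S = k - 1}. if insert i S \<in> E then \<Prod>j\<in>S. x j else 0)"
    unfolding \<A>_def using finite_subsets by (rule sum.inter_filter)
  also have "\<dots> = (\<Sum>S\<in>{S. S \<subseteq> D \<and> card S = k - 1}. adj E S i * (\<Prod>j\<in>S. x j))"
    by (intro sum.cong) (auto simp: adj_def)
  finally have A: "(\<Sum>S\<in>\<A>. \<Prod>j\<in>S. x j) =
      (\<Sum>S\<in>{S. S \<subseteq> D \<and> card S = k - 1}. adj E S i * (\<Prod>j\<in>S. x j))" .
  have B_C: "\<exists>u. S \<inter> C = {u}" if "S \<in> \<B>" for S
  proof -
    have "insert i S \<inter> C = S \<inter> C" using assms disjoint by auto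
    then have "card (S \<inter> C) \<le> 1" using sparse[of "insert i S"] that by (simp add: \<B>_def)
    moreover have "S \<inter> C \<noteq> {}" using that V by (auto simp: \<B>_def)
    moreover have "finite (S \<inter> C)" using finite_sets by auto
    ultimately have "card (S \<inter> C) = 1" by (simp add: card_gt_0_iff le_antisym Suc_le_eq)
    then show ?thesis by (auto simp: card_1_singleton_iff)
  qed
  have finT: "finite S" if "S \<in> \<T>" for S
    using that finite_sets by (auto simp: \<T>_def intro: finite_subset)
  \<comment> \<open>An element of \<open>\<B>\<close> is split into its part in \<open>D\<close> and its unique element of \<open>C\<close>.\<close>
  have "(\<Sum>S\<in>\<B>. \<Prod>j\<in>S. x j) =
      (\<Sum>(S, u)\<in>{p \<in> \<T> \<times> C. insert (snd p) (insert i (fst p)) \<in> E}. (\<Prod>j\<in>S. x j) * x u)"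
  proof (rule sum.reindex_bij_witness[where j = "\<lambda>S. (S \<inter> D, the_elem (S \<inter> C))"
        and i = "\<lambda>(S, u). insert u S"])
    fix S assume S: "S \<in> \<B>"
    then obtain u where u: "S \<inter> C = {u}" using B_C by blast
    have SD: "S = insert u (S \<inter> D)" using u S V by (auto simp: \<B>_def)
    have uD: "u \<notin> S \<inter> D" "u \<in> C" using u disjoint by auto
    have finS: "finite (S \<inter> D)" using finite_sets by auto
    have "card S = Suc (card (S \<inter> D))"
      using card_insert_disjoint[OF finS uD(1)] SD by simp
    moreover have "i \<notin> S" using S not_mem_link by (auto simp: \<B>_def)
    ultimately have "S \<inter> D \<in> \<T>" using S by (auto simp: \<T>_def \<B>_def)
    moreover have "insert u (insert i (S \<inter> D)) = insert i S" using SD by blast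
    ultimately show "(S \<inter> D, the_elem (S \<inter> C)) \<in> {p \<in> \<T> \<times> C. insert (snd p) (insert i (fst p)) \<in> E}"
      using u uD S by (simp add: \<B>_def)
    show "(case (S \<inter> D, the_elem (S \<inter> C)) of (S, u) \<Rightarrow> insert u S) = S"
      using u SD by simp
    have "(\<Prod>j\<in>S. x j) = (\<Prod>j\<in>S \<inter> D. x j) * x u"
      using uD finS by (subst SD) (simp add: mult.commute)
    then show "(case (S \<inter> D, the_elem (S \<inter> C)) of (S, u) \<Rightarrow> (\<Prod>j\<in>S. x j) * x u) = (\<Prod>j\<in>S. x j)"
      using u by simp
  next
    fix p assume "p \<in> {p \<in> \<T> \<times> C. insert (snd p) (insert i (fst p)) \<in> E}"
    then obtain S u where p: "p = (S, u)" "S \<in> \<T>" "u \<in> C" "insert u (insert i S) \<in> E" by auto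
    have u: "u \<notin> D" "u \<notin> S" using p disjoint by (auto simp: \<T>_def)
    have S: "S \<subseteq> D" using p by (simp add: \<T>_def)
    have "insert u S \<inter> D = S" "insert u S \<inter> C = {u}" using u S p(3) disjoint by auto
    then show "((case p of (S, u) \<Rightarrow> insert u S) \<inter> D, the_elem ((case p of (S, u) \<Rightarrow> insert u S) \<inter> C)) = p"
      by (simp add: p(1))
    have "card (insert u S) = k - 1" using u finT[OF p(2)] p(2) k by (simp add: \<T>_def)
    then show "(case p of (S, u) \<Rightarrow> insert u S) \<in> \<B>"
      using p u S V by (auto simp: \<B>_def insert_commute)
  qed
  also have "\<dots> = (\<Sum>(S, u)\<in>\<T> \<times> C. if insert u (insert i S) \<in> E then (\<Prod>j\<in>S. x j) * x u else 0)"
    using fin(3) finite_sets(2) by (simp add: sum.inter_filter[symmetric] case_prod_unfold)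
  also have "\<dots> = (\<Sum>(S, u)\<in>\<T> \<times> C. (\<Prod>j\<in>S. x j) * (adj E (insert i S) u * x u))"
    by (intro sum.cong) (auto simp: adj_def)
  also have "\<dots> = (\<Sum>S\<in>\<T>. (\<Prod>j\<in>S. x j) * (\<Sum>u\<in>C. adj E (insert i S) u * x u))"
    by (simp add: sum.cartesian_product[symmetric] sum_distrib_left)
  finally show ?thesis by (simp add: split A \<T>_def)
qed

end

text \<open>If the neighbourhood vectors of all \<open>(k - 1)\<close>-subsets of \<open>D\<close> are transformed by the symmetric
  matrix \<open>M = 1 - s w w\<^sup>T\<close>, the adjacency tensor is transformed by \<open>M\<close> in all its indices: in the
  components at \<open>C\<close> these vectors are the output, and in the components at \<open>D\<close> they are paired with
  \<open>x\<close>, so that \<open>M\<close> can be moved to \<open>x\<close> by symmetry.\<close>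
lemma tensor_apply_reflected:
  assumes E: "sparse_hypergraph k V C D E" and H: "sparse_hypergraph k V C D H"
    and w: "\<And>v. v \<notin> C \<Longrightarrow> w v = 0"
    and inside_D: "\<And>S i. S \<subseteq> D \<Longrightarrow> i \<in> D \<Longrightarrow> adj H S i = adj E S i"
    and adj: "\<And>S u. S \<subseteq> D \<Longrightarrow> card S = k - 1 \<Longrightarrow> u \<in> C \<Longrightarrow> adj H S u = reflect C w s (adj E S) u"
    and i: "i \<in> V"
  shows "tensor_apply V k (adjacency_tensor k H) x i =
    reflect V w s (tensor_apply V k (adjacency_tensor k E) (reflect V w s x)) i"
proof -
  interpret E: sparse_hypergraph k V C D E by fact
  interpret H: sparse_hypergraph k V C D H by fact
  have VC: "reflect V w s = reflect C w s"
  proof (intro ext)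
    fix y v
    have "(\<Sum>l\<in>V. w l * y l) = (\<Sum>l\<in>C. w l * y l)"
      using E.finite_sets E.V w by (intro sum.mono_neutral_right) auto
    then show "reflect V w s y v = reflect C w s y v" by (simp add: reflect_def)
  qed
  have D: "reflect C w s y j = y j" if "j \<in> D" for y j
    using w[of j] that E.disjoint by (auto simp: reflect_def)
  have prod: "(\<Prod>j\<in>S. reflect C w s x j) = (\<Prod>j\<in>S. x j)" if "S \<subseteq> D" for S
    using that D by (intro prod.cong) auto
  let ?P = "{S. S \<subseteq> D \<and> card S = k - 1}"
  define f where "f = tensor_apply V k (adjacency_tensor k E) (reflect C w s x)"
  show ?thesis
  proof (cases "i \<in> C")
    case True
    have f: "f v = (\<Sum>S\<in>?P. adj E S v * (\<Prod>j\<in>S. x j))" if "v \<in> C" for v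
      unfolding f_def E.tensor_apply_at_C[OF that] by (intro sum.cong) (auto simp: prod)
    have "tensor_apply V k (adjacency_tensor k H) x i =
        (\<Sum>S\<in>?P. reflect C w s (adj E S) i * (\<Prod>j\<in>S. x j))"
      unfolding H.tensor_apply_at_C[OF True] by (intro sum.cong) (auto simp: adj True)
    also have "\<dots> = (\<Sum>S\<in>?P. adj E S i * (\<Prod>j\<in>S. x j)) -
        s * w i * (\<Sum>S\<in>?P. \<Sum>v\<in>C. w v * (adj E S v * (\<Prod>j\<in>S. x j)))"
      by (simp add: reflect_def left_diff_distrib sum_subtractf sum_distrib_left sum_distrib_right mult.assoc)
    also have "(\<Sum>S\<in>?P. \<Sum>v\<in>C. w v * (adj E S v * (\<Prod>j\<in>S. x j))) = (\<Sum>v\<in>C. w v * f v)"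
      by (subst sum.swap) (simp add: f sum_distrib_left)
    also have "(\<Sum>S\<in>?P. adj E S i * (\<Prod>j\<in>S. x j)) = f i" by (simp add: f True)
    finally show ?thesis by (simp add: VC reflect_def[of C w s "tensor_apply _ _ _ _"] f_def)
  next
    case False
    then have i: "i \<in> D" using i E.V by auto
    let ?T = "{S. S \<subseteq> D \<and> card S = k - 2 \<and> i \<notin> S}"
    have link: "(\<Sum>u\<in>C. adj H (insert i S) u * x u) =
        (\<Sum>u\<in>C. adj E (insert i S) u * reflect C w s x u)" if "S \<in> ?T" for S
    proof -
      have "finite S" using that E.finite_sets by (auto intro: finite_subset)
      then have "insert i S \<subseteq> D" "card (insert i S) = k - 1"
        using that i E.k by auto
      then have "(\<Sum>u\<in>C. adj H (insert i S) u * x u) =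
          (\<Sum>u\<in>C. reflect C w s (adj E (insert i S)) u * x u)"
        by (intro sum.cong) (simp_all add: adj)
      then show ?thesis by (simp only: reflect_self_adjoint)
    qed
    have "tensor_apply V k (adjacency_tensor k H) x i = f i"
      unfolding f_def H.tensor_apply_at_D[OF i] E.tensor_apply_at_D[OF i]
      by (intro arg_cong2[where f = "(+)"] sum.cong refl)
         (simp_all add: inside_D i prod link)
    then show ?thesis using D[OF i] by (simp add: VC f_def)
  qed
qed

section \<open>Switching is a reflection\<close>

text \<open>With \<open>w\<close> equal to \<open>1\<close> on \<open>C1\<close> and \<open>- 1\<close> on \<open>C2\<close>, the reflection exchanges the indicator vectors
  of \<open>C1\<close> and \<open>C2\<close> and fixes every indicator vector that is balanced between them. These are
  precisely the effects of the switching on a neighbourhood; the factor is \<open>2 / (w \<bullet> w) = 1 / t\<close>.\<close>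
lemma adj_switched:
  assumes uniform: "uniform_hypergraph k V E" and k: "k \<ge> 2"
    and V: "V = C1 \<union> C2 \<union> D"
    and disj: "C1 \<inter> C2 = {}" "C1 \<inter> D = {}" "C2 \<inter> D = {}"
    and card: "card C1 = t" "card C2 = t" and t: "t > 0"
    and S: "S \<subseteq> D" "card S = k - 1" and u: "u \<in> C1 \<union> C2"
    and nbhd: "nbhd E S \<inter> (C1 \<union> C2) \<in> {C1, C2} \<or>
      card (nbhd E S \<inter> C1) = card (nbhd E S \<inter> C2)"
  shows "adj (switched_edges k V E C1 C2 D) S u =
    reflect (C1 \<union> C2) (\<lambda>v. of_bool (v \<in> C1) - of_bool (v \<in> C2)) (1 / of_nat t) (adj E S) u"
proof -
  let ?w = "\<lambda>v. of_bool (v \<in> C1) - of_bool (v \<in> C2) :: complex"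
  let ?N = "nbhd E S"
  have fin: "finite C1" "finite C2" "finite S"
    using card t S k by (auto intro: card_ge_0_finite)
  have uS: "u \<notin> S" using u S disj by auto
  have edge: "insert u S \<subseteq> V" "card (insert u S) = k"
    using u S V uS fin k by auto
  \<comment> \<open>The set \<open>S\<close> can be recovered from the edge, so membership in the switched family is decided by \<open>S\<close>.\<close>
  have "S' = S" if "S' \<subseteq> D" "u' \<in> C1 \<union> C2" "insert u S = insert u' S'" for S' u'
  proof -
    have "insert u S \<inter> D = S" "insert u' S' \<inter> D = S'" using that u S disj by auto
    then show ?thesis using that by simp
  qed
  then have switched: "is_switched k E C1 C2 D (insert u S) \<longleftrightarrow> ?N \<inter> (C1 \<union> C2) \<in> {C1, C2}"
    using S u unfolding is_switched_def by blast
  have dot: "(\<Sum>v\<in>C1 \<union> C2. ?w v * adj E S v) = of_nat (card (?N \<inter> C1)) - of_nat (card (?N \<inter> C2))"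
  proof -
    have "(\<Sum>v\<in>C. adj E S v) = of_nat (card (?N \<inter> C))" if "finite C" for C
      using that by (simp add: adj_def nbhd_def of_bool_def sum.If_cases Int_commute Collect_conj_eq)
    moreover have "(\<Sum>v\<in>C1 \<union> C2. ?w v * adj E S v) = (\<Sum>v\<in>C1. adj E S v) + (\<Sum>v\<in>C2. - adj E S v)"
      using fin disj
      by (subst sum.union_disjoint) (auto intro!: arg_cong2[where f = "(+)"] sum.cong)
    ultimately show ?thesis using fin by (simp add: sum_negf)
  qed
  have H: "adj (switched_edges k V E C1 C2 D) S u =
      (if ?N \<inter> (C1 \<union> C2) \<in> {C1, C2} then 1 - adj E S u else adj E S u)"
    using edge by (simp add: adj_def switched_edges_def switched del: insert_iff)
  have N: "adj E S u = of_bool (u \<in> ?N)" by (simp add: adj_def nbhd_def)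
  have ne: "C1 \<noteq> {}" "C2 \<noteq> {}" using card t by auto
  consider "?N \<inter> (C1 \<union> C2) = C1" | "?N \<inter> (C1 \<union> C2) = C2"
    | "?N \<inter> (C1 \<union> C2) \<notin> {C1, C2}" "card (?N \<inter> C1) = card (?N \<inter> C2)"
    using nbhd by auto
  then show ?thesis
  proof cases
    case 1
    then have "?N \<inter> C1 = C1" "?N \<inter> C2 = {}" "u \<in> ?N \<longleftrightarrow> u \<in> C1" using disj u by auto
    then show ?thesis
      using u disj t 1 card by (auto simp: H N reflect_def dot)
  next
    case 2
    then have "?N \<inter> C1 = {}" "?N \<inter> C2 = C2" "u \<in> ?N \<longleftrightarrow> u \<in> C2" using disj u by auto
    then show ?thesis
      using u disj t 2 card by (auto simp: H N reflect_def dot)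
  next
    case 3
    then show ?thesis by (simp add: H reflect_def dot)
  qed
qed

lemma sparse_switched_edges:
  assumes "uniform_hypergraph k V E" and "V = C1 \<union> C2 \<union> D" "(C1 \<union> C2) \<inter> D = {}" "k \<ge> 2"
    and sparse: "\<And>e. e \<in> E \<Longrightarrow> card (e \<inter> (C1 \<union> C2)) \<le> 1"
  shows "sparse_hypergraph k V (C1 \<union> C2) D (switched_edges k V E C1 C2 D)"
proof
  fix e assume e: "e \<in> switched_edges k V E C1 C2 D"
  show "card (e \<inter> (C1 \<union> C2)) \<le> 1"
  proof (cases "is_switched k E C1 C2 D e")
    case True
    then obtain S u where "S \<subseteq> D" "u \<in> C1 \<union> C2" "e = insert u S" by (auto simp: is_switched_def)
    then have "e \<inter> (C1 \<union> C2) = {u}" using assms(3) by auto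
    then show ?thesis by simp
  next
    case False
    then show ?thesis using e sparse by (simp add: switched_edges_def)
  qed
qed (use assms in \<open>auto simp: switched_edges_def uniform_hypergraph_def\<close>)

theorem theorem2p6:
  fixes k t :: nat
    and V C1 C2 D :: "'a set"
    and E :: "'a set set"
  assumes "k \<ge> 2"
    and "uniform_hypergraph k V E"
    and "V = C1 \<union> C2 \<union> D"
    and "C1 \<inter> C2 = {}" and "C1 \<inter> D = {}" and "C2 \<inter> D = {}"
    and "card C1 = t" and "card C2 = t"
    and "\<And>e. e \<in> E \<Longrightarrow> card (e \<inter> (C1 \<union> C2)) \<le> 1"
    and "\<And>S. S \<subseteq> D \<Longrightarrow> card S = k - 1 \<Longrightarrow>
           nbhd E S \<inter> (C1 \<union> C2) \<in> {C1, C2} \<or>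
           card (nbhd E S \<inter> C1) = card (nbhd E S \<inter> C2)"
  shows "uniform_hypergraph k V (switched_edges k V E C1 C2 D) \<and>
         E_cospectral k V E V (switched_edges k V E C1 C2 D)"
proof
  let ?H = "switched_edges k V E C1 C2 D"
  let ?C = "C1 \<union> C2"
  have CD: "?C \<inter> D = {}" using assms(5,6) by auto
  have E: "sparse_hypergraph k V ?C D E" using assms CD by unfold_locales auto
  have H: "sparse_hypergraph k V ?C D ?H"
    by (rule sparse_switched_edges[OF assms(2,3) CD assms(1,9)])
  then show "uniform_hypergraph k V ?H" by (rule sparse_hypergraph.uniform)
  have fin: "finite V" "finite C1" "finite C2"
    using assms(2,3) by (auto simp: uniform_hypergraph_def)
  show "E_cospectral k V E V ?H"
  proof (cases "t = 0")
    case True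
    \<comment> \<open>The vector \<open>w\<close> of the reflection would be zero here; but nothing is switched.\<close>
    then have "C1 = {}" "C2 = {}" using assms(7,8) fin by auto
    then have "?H = E"
      using assms(2) by (auto simp: switched_edges_def is_switched_def uniform_hypergraph_def)
    then show ?thesis by (simp add: E_cospectral_def)
  next
    case False
    define w :: "'a \<Rightarrow> complex" where "w = (\<lambda>v. of_bool (v \<in> C1) - of_bool (v \<in> C2))"
    have norm: "(\<Sum>v\<in>V. w v ^ 2) = 2 * of_nat t"
    proof -
      have "(\<Sum>v\<in>V. w v ^ 2) = (\<Sum>v\<in>C1 \<union> C2. 1)"
        using fin assms(3,4) CD by (intro sum.mono_neutral_cong_right) (auto simp: w_def)
      then show ?thesis using fin assms(4,7,8) by (simp add: card_Un_disjoint)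
    qed
    then have s: "2 / (\<Sum>v\<in>V. w v ^ 2) = 1 / of_nat t" using False by simp
    have "E_charpoly V k (adjacency_tensor k ?H) = E_charpoly V k (adjacency_tensor k E)"
    proof (rule E_charpoly_reflected[OF fin(1) assms(1)])
      show "(\<Sum>v\<in>V. w v ^ 2) \<noteq> 0" using norm False by simp
      show "tensor_apply V k (adjacency_tensor k ?H) x i = reflect V w (2 / (\<Sum>v\<in>V. w v ^ 2))
          (tensor_apply V k (adjacency_tensor k E) (reflect V w (2 / (\<Sum>v\<in>V. w v ^ 2)) x)) i"
        if "i \<in> V" for x i
        unfolding s
      proof (rule tensor_apply_reflected[OF E H _ _ _ that])
        show "w v = 0" if "v \<notin> ?C" for v using that by (simp add: w_def)
        show "adj ?H S i = adj E S i" if "S \<subseteq> D" "i \<in> D" for S i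
        proof -
          have "u \<notin> insert i S" if "u \<in> ?C" for u
            using that \<open>S \<subseteq> D\<close> \<open>i \<in> D\<close> CD by auto
          then have "\<not> is_switched k E C1 C2 D (insert i S)"
            unfolding is_switched_def by blast
          then have "insert i S \<in> ?H \<longleftrightarrow> insert i S \<in> E"
            using assms(2) by (auto simp: switched_edges_def uniform_hypergraph_def)
          then show ?thesis by (simp add: adj_def)
        qed
        show "adj ?H S u = reflect ?C w (1 / of_nat t) (adj E S) u"
          if "S \<subseteq> D" "card S = k - 1" "u \<in> ?C" for S u
          unfolding w_def
          by (rule adj_switched[OF assms(2,1,3-8) _ that assms(10)[OF that(1,2)]])
             (use False in simp)
      qed
    qed
    then show ?thesis by (simp add: E_cospectral_def)
  qed
qed

end
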